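(* Every causally simple spacetime $(M,g)$ is causally continuous. In particular, for every admissible measure $m$ on $M$, the volume functions $t^-(p)=m(I^-(p))$ and $t^+(p)=-m(I^+(p))$ are time functions on $M$.
   Context: A spacetime $(M,g)$ is a connected, time-oriented $C^k$ Lorentzian manifold of dimension $n_0\ge 2$ ($k\in\{1,2,\dots,\infty\}$), signature $(-,+,\dots,+)$; "smooth" means $C^k$. A tangent vector $v\ne 0$ is timelike if $g(v,v)<0$ and causal if $g(v,v)\le 0$; the zero vector is regarded as spacelike. Timelike and causal curves are piecewise smooth curves with timelike, resp. causal, velocity, such that at each break the two limit tangent vectors lie in the same causal cone. Write $p\ll q$ if there is a future-directed timelike curve from $p$ to $q$, and $p\le q$ if $p=q$ or there is a future-directed causal curve from $p$ to $q$; $I^+(p)=\{q: p\ll q\}$, $I^-(p)=\{q: q\ll p\}$, $J^+(p)=\{q: p\le q\}$, $J^-(p)=\{q: q\le p\}$. Admissible measure: a Borel measure $m$ on $M$ (possibly completed) such that (1) $m(M)<\infty$; (2) $m(U)>0$ for every non-empty open $U\subseteq M$; (3) $m(\partial I^+(p))=m(\partial I^-(p))=0$ for every $p\in M$. Time function: a continuous function $t:M\to\mathbb{R}$ that is strictly increasing along every future-directed causal curve. Distinguishing: $p\ne q$ implies $I^-(p)\ne I^-(q)$ and $I^+(p)\neq I^+(q)$. Causally simple: distinguishing, and $J^+(p)$ and $J^-(p)$ are closed for every $p\in M$. Outer continuity: the set-valued function $I^-$ is outer continuous if for every $p\in M$ and every compact $K\subset M\setminus\overline{I^-(p)}$ there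 is an open neighborhood $U\ni p$ such that $K\subset M\setminus\overline{I^-(q)}$ for all $q\in U$. Similarly for $I^+$. Causally continuous: distinguishing, and $I^-$ and $I^+$ are both outer continuous. *)

theory Defs
  imports "HOL-Analysis.Analysis" "HOL-Library.Extended_Nat"
begin

section \<open>Maps of class \<open>C\<^sup>k\<close>\<close>

text \<open>
  The definitions are used for open sets \<open>S\<close> and, in the case of curves, for relatively open subsets
  of a non-degenerate compact real interval. In both cases the derivative within \<open>S\<close> is unique; in
  the second one it is the one-sided derivative at an end point of the interval.
\<close>

fun times_differentiable_on ::
  "nat \<Rightarrow> 'c::real_normed_vector set \<Rightarrow> ('c \<Rightarrow> 'd::real_normed_vector) \<Rightarrow> bool" where
  "times_differentiable_on 0 S f \<longleftrightarrow> continuous_on S f"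
| "times_differentiable_on (Suc n) S f \<longleftrightarrow>
     (\<forall>x\<in>S. f differentiable (at x within S)) \<and>
     (\<forall>v. times_differentiable_on n S (\<lambda>x. frechet_derivative f (at x within S) v))"

definition Ck_on ::
  "enat \<Rightarrow> 'c::real_normed_vector set \<Rightarrow> ('c \<Rightarrow> 'd::real_normed_vector) \<Rightarrow> bool" where
  "Ck_on k S f \<longleftrightarrow> (\<forall>n. enat n \<le> k \<longrightarrow> times_differentiable_on n S f)"


section \<open>Charts and Lorentzian structures\<close>

text \<open>A chart is a pair of its domain and its coordinate map.\<close>

type_synonym ('a, 'b) chart = "'a set \<times> ('a \<Rightarrow> 'b)"

abbreviation chart_dom :: "('a, 'b) chart \<Rightarrow> 'a set" where
  "chart_dom c \<equiv> fst c"

abbreviation chart_map :: "('a, 'b) chart \<Rightarrow> 'a \<Rightarrow> 'b" where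
  "chart_map c \<equiv> snd c"

definition chart_inv :: "('a, 'b) chart \<Rightarrow> 'b \<Rightarrow> 'a" where
  "chart_inv c = inv_into (chart_dom c) (chart_map c)"

definition chart_range :: "('a, 'b) chart \<Rightarrow> 'b set" where
  "chart_range c = chart_map c ` chart_dom c"

definition is_chart :: "('a::topological_space, 'b::euclidean_space) chart \<Rightarrow> bool" where
  "is_chart c \<longleftrightarrow> open (chart_dom c) \<and> open (chart_range c) \<and>
     homeomorphism (chart_dom c) (chart_range c) (chart_map c) (chart_inv c)"

definition transition :: "('a, 'b) chart \<Rightarrow> ('a, 'b) chart \<Rightarrow> 'b \<Rightarrow> 'b" where
  "transition c d = chart_map d \<circ> chart_inv c"

definition transition_dom :: "('a, 'b) chart \<Rightarrow> ('a, 'b) chart \<Rightarrow> 'b set" where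
  "transition_dom c d = chart_map c ` (chart_dom c \<inter> chart_dom d)"

definition Ck_atlas ::
  "enat \<Rightarrow> ('a::topological_space, 'b::euclidean_space) chart set \<Rightarrow> bool" where
  "Ck_atlas k A \<longleftrightarrow> (\<forall>c\<in>A. is_chart c) \<and> (\<Union>c\<in>A. chart_dom c) = UNIV \<and>
     (\<forall>c\<in>A. \<forall>d\<in>A. Ck_on k (transition_dom c d) (transition c d))"

text \<open>
  The underlying set of the manifold is the universe of the type \<open>'a\<close>, and its dimension is the
  dimension of the model space \<open>'b\<close>. Tensor fields are given by their components in the charts of
  the atlas: \<open>metric M c x u v\<close> is the value of the metric at the point with coordinates \<open>x\<close> in the
  chart \<open>c\<close> on the tangent vectors with components \<open>u\<close> and \<open>v\<close> in that chart, and
  \<open>orientation M c x\<close> are the components in \<open>c\<close> of the vector field defining the time orientation.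
\<close>

record ('a, 'b) lorentz_structure =
  smoothness :: enat
  atlas :: "('a, 'b) chart set"
  metric :: "('a, 'b) chart \<Rightarrow> 'b \<Rightarrow> 'b \<Rightarrow> 'b \<Rightarrow> real"
  orientation :: "('a, 'b) chart \<Rightarrow> 'b \<Rightarrow> 'b"

text \<open>Symmetric bilinear forms of signature \<open>(-, +, \<dots>, +)\<close>.\<close>

definition lorentzian_form :: "('b::euclidean_space \<Rightarrow> 'b \<Rightarrow> real) \<Rightarrow> bool" where
  "lorentzian_form h \<longleftrightarrow> bilinear h \<and> (\<forall>u v. h u v = h v u) \<and>
     (\<exists>(e :: 'b \<Rightarrow> 'b) (i0 :: 'b). i0 \<in> Basis \<and> linear e \<and> bij e \<and>
        (\<forall>i\<in>Basis. \<forall>j\<in>Basis. h (e i) (e j) = (if i \<noteq> j then 0 else if i = i0 then -1 else 1)))"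

text \<open>
  The atlas need not be maximal: a metric of class \<open>C\<^sup>k\<close> is one whose components are \<open>C\<^sup>k\<close> in all
  charts of the given atlas. An atlas with transition maps of class \<open>C\<^sup>k\<^sup>+\<^sup>1\<close> is thus allowed,
  but not required.
\<close>

definition Ck_lorentzian_metric ::
  "('a::topological_space, 'b::euclidean_space) lorentz_structure \<Rightarrow> bool" where
  "Ck_lorentzian_metric M \<longleftrightarrow>
     (\<forall>c\<in>atlas M. \<forall>x\<in>chart_range c. lorentzian_form (metric M c x)) \<and>
     (\<forall>c\<in>atlas M. \<forall>u v. Ck_on (smoothness M) (chart_range c) (\<lambda>x. metric M c x u v)) \<and>
     (\<forall>c\<in>atlas M. \<forall>d\<in>atlas M. \<forall>x\<in>transition_dom c d. \<forall>u v.
        metric M c x u v =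
        metric M d (transition c d x)
          (frechet_derivative (transition c d) (at x) u)
          (frechet_derivative (transition c d) (at x) v))"

definition time_orientation ::
  "('a::topological_space, 'b::euclidean_space) lorentz_structure \<Rightarrow> bool" where
  "time_orientation M \<longleftrightarrow>
     (\<forall>c\<in>atlas M. continuous_on (chart_range c) (orientation M c)) \<and>
     (\<forall>c\<in>atlas M. \<forall>x\<in>chart_range c. metric M c x (orientation M c x) (orientation M c x) < 0) \<and>
     (\<forall>c\<in>atlas M. \<forall>d\<in>atlas M. \<forall>x\<in>transition_dom c d.
        orientation M d (transition c d x) =
        frechet_derivative (transition c d) (at x) (orientation M c x))"

definition spacetime ::
  "('a::{t2_space, second_countable_topology}, 'b::euclidean_space) lorentz_structure \<Rightarrow> bool" where
  "spacetime M \<longleftrightarrow> 1 \<le> smoothness M \<and> 2 \<le> DIM('b) \<and> connected (UNIV :: 'a set) \<and>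
     Ck_atlas (smoothness M) (atlas M) \<and> Ck_lorentzian_metric M \<and> time_orientation M"


section \<open>Causality\<close>

definition timelike ::
  "('a, 'b::euclidean_space) lorentz_structure \<Rightarrow> ('a, 'b) chart \<Rightarrow> 'b \<Rightarrow> 'b \<Rightarrow> bool" where
  "timelike M c x v \<longleftrightarrow> v \<noteq> 0 \<and> metric M c x v v < 0"

definition causal ::
  "('a, 'b::euclidean_space) lorentz_structure \<Rightarrow> ('a, 'b) chart \<Rightarrow> 'b \<Rightarrow> 'b \<Rightarrow> bool" where
  "causal M c x v \<longleftrightarrow> v \<noteq> 0 \<and> metric M c x v v \<le> 0"

text \<open>
  For the signature \<open>(-, +, \<dots>, +)\<close>, a causal vector lies in the same causal cone as the timelike
  vector defining the time orientation iff its product with the latter is negative.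
\<close>

definition future_directed ::
  "('a, 'b::euclidean_space) lorentz_structure \<Rightarrow> ('a, 'b) chart \<Rightarrow> 'b \<Rightarrow> 'b \<Rightarrow> bool" where
  "future_directed M c x v \<longleftrightarrow> metric M c x v (orientation M c x) < 0"

definition Ck_segment ::
  "('a::topological_space, 'b::euclidean_space) lorentz_structure \<Rightarrow> (real \<Rightarrow> 'a) \<Rightarrow> real \<Rightarrow> real \<Rightarrow> bool" where
  "Ck_segment M \<gamma> a b \<longleftrightarrow> a < b \<and> continuous_on {a..b} \<gamma> \<and>
     (\<forall>c\<in>atlas M. Ck_on (smoothness M) {s\<in>{a..b}. \<gamma> s \<in> chart_dom c} (chart_map c \<circ> \<gamma>))"

definition velocity ::
  "('a, 'b::euclidean_space) chart \<Rightarrow> (real \<Rightarrow> 'a) \<Rightarrow> real \<Rightarrow> real \<Rightarrow> real \<Rightarrow> 'b" where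
  "velocity c \<gamma> a b s = vector_derivative (chart_map c \<circ> \<gamma>) (at s within {a..b})"

text \<open>
  Piecewise \<open>C\<^sup>k\<close> future-directed curves on \<open>[a, b]\<close> whose velocities have the property \<open>P\<close> (timelike or
  causal). The breaks are \<open>\<tau> 1, \<dots>, \<tau> (N - 1)\<close>. Each piece satisfies the conditions on its closed
  parameter interval, so both limit tangent vectors at a break are future-directed and
  satisfy \<open>P\<close>; in particular, they lie in the same causal cone.
\<close>

definition future_curve ::
  "('a::topological_space, 'b::euclidean_space) lorentz_structure \<Rightarrow>
   (('a, 'b) lorentz_structure \<Rightarrow> ('a, 'b) chart \<Rightarrow> 'b \<Rightarrow> 'b \<Rightarrow> bool) \<Rightarrow>
   (real \<Rightarrow> 'a) \<Rightarrow> real \<Rightarrow> real \<Rightarrow> bool" where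
  "future_curve M P \<gamma> a b \<longleftrightarrow>
     (\<exists>(N::nat) (\<tau> :: nat \<Rightarrow> real). 0 < N \<and> \<tau> 0 = a \<and> \<tau> N = b \<and>
        (\<forall>i<N. Ck_segment M \<gamma> (\<tau> i) (\<tau> (Suc i)) \<and>
           (\<forall>s\<in>{\<tau> i..\<tau> (Suc i)}. \<forall>c\<in>atlas M. \<gamma> s \<in> chart_dom c \<longrightarrow>
              P M c (chart_map c (\<gamma> s)) (velocity c \<gamma> (\<tau> i) (\<tau> (Suc i)) s) \<and>
              future_directed M c (chart_map c (\<gamma> s)) (velocity c \<gamma> (\<tau> i) (\<tau> (Suc i)) s))))"

abbreviation future_timelike_curve ::
  "('a::topological_space, 'b::euclidean_space) lorentz_structure \<Rightarrow> (real \<Rightarrow> 'a) \<Rightarrow> real \<Rightarrow> real \<Rightarrow> bool" where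
  "future_timelike_curve M \<equiv> future_curve M timelike"

abbreviation future_causal_curve ::
  "('a::topological_space, 'b::euclidean_space) lorentz_structure \<Rightarrow> (real \<Rightarrow> 'a) \<Rightarrow> real \<Rightarrow> real \<Rightarrow> bool" where
  "future_causal_curve M \<equiv> future_curve M causal"

definition chron_less ::
  "('a::topological_space, 'b::euclidean_space) lorentz_structure \<Rightarrow> 'a \<Rightarrow> 'a \<Rightarrow> bool" where
  "chron_less M p q \<longleftrightarrow> (\<exists>\<gamma> a b. future_timelike_curve M \<gamma> a b \<and> \<gamma> a = p \<and> \<gamma> b = q)"

definition causal_le ::
  "('a::topological_space, 'b::euclidean_space) lorentz_structure \<Rightarrow> 'a \<Rightarrow> 'a \<Rightarrow> bool" where
  "causal_le M p q \<longleftrightarrow> p = q \<or> (\<exists>\<gamma> a b. future_causal_curve M \<gamma> a b \<and> \<gamma> a = p \<and> \<gamma> b = q)"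

definition I_plus ::
  "('a::topological_space, 'b::euclidean_space) lorentz_structure \<Rightarrow> 'a \<Rightarrow> 'a set" where
  "I_plus M p = {q. chron_less M p q}"

definition I_minus ::
  "('a::topological_space, 'b::euclidean_space) lorentz_structure \<Rightarrow> 'a \<Rightarrow> 'a set" where
  "I_minus M p = {q. chron_less M q p}"

definition J_plus ::
  "('a::topological_space, 'b::euclidean_space) lorentz_structure \<Rightarrow> 'a \<Rightarrow> 'a set" where
  "J_plus M p = {q. causal_le M p q}"

definition J_minus ::
  "('a::topological_space, 'b::euclidean_space) lorentz_structure \<Rightarrow> 'a \<Rightarrow> 'a set" where
  "J_minus M p = {q. causal_le M q p}"

definition distinguishing ::
  "('a::topological_space, 'b::euclidean_space) lorentz_structure \<Rightarrow> bool" where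
  "distinguishing M \<longleftrightarrow>
     (\<forall>p q. p \<noteq> q \<longrightarrow> I_minus M p \<noteq> I_minus M q \<and> I_plus M p \<noteq> I_plus M q)"

definition causally_simple ::
  "('a::topological_space, 'b::euclidean_space) lorentz_structure \<Rightarrow> bool" where
  "causally_simple M \<longleftrightarrow> distinguishing M \<and> (\<forall>p. closed (J_plus M p) \<and> closed (J_minus M p))"

definition outer_continuous :: "('a::topological_space \<Rightarrow> 'a set) \<Rightarrow> bool" where
  "outer_continuous F \<longleftrightarrow>
     (\<forall>p K. compact K \<and> K \<subseteq> - closure (F p) \<longrightarrow>
        (\<exists>U. open U \<and> p \<in> U \<and> (\<forall>q\<in>U. K \<subseteq> - closure (F q))))"

definition causally_continuous ::
  "('a::topological_space, 'b::euclidean_space) lorentz_structure \<Rightarrow> bool" where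
  "causally_continuous M \<longleftrightarrow>
     distinguishing M \<and> outer_continuous (I_minus M) \<and> outer_continuous (I_plus M)"


section \<open>Admissible measures and time functions\<close>

definition borel_or_completed :: "'a::topological_space measure \<Rightarrow> bool" where
  "borel_or_completed m \<longleftrightarrow> (\<exists>m0. sets m0 = sets borel \<and> (m = m0 \<or> m = completion m0))"

definition admissible_measure ::
  "('a::topological_space, 'b::euclidean_space) lorentz_structure \<Rightarrow> 'a measure \<Rightarrow> bool" where
  "admissible_measure M m \<longleftrightarrow> borel_or_completed m \<and>
     emeasure m UNIV < \<infinity> \<and>
     (\<forall>U. open U \<and> U \<noteq> {} \<longrightarrow> 0 < emeasure m U) \<and>
     (\<forall>p. emeasure m (frontier (I_plus M p)) = 0 \<and> emeasure m (frontier (I_minus M p)) = 0)"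

definition is_time_function ::
  "('a::topological_space, 'b::euclidean_space) lorentz_structure \<Rightarrow> ('a \<Rightarrow> real) \<Rightarrow> bool" where
  "is_time_function M t \<longleftrightarrow> continuous_on UNIV t \<and>
     (\<forall>\<gamma> a b. future_causal_curve M \<gamma> a b \<longrightarrow> strict_mono_on {a..b} (t \<circ> \<gamma>))"

definition past_volume ::
  "('a::topological_space, 'b::euclidean_space) lorentz_structure \<Rightarrow> 'a measure \<Rightarrow> 'a \<Rightarrow> real" where
  "past_volume M m p = measure m (I_minus M p)"

definition future_volume ::
  "('a::topological_space, 'b::euclidean_space) lorentz_structure \<Rightarrow> 'a measure \<Rightarrow> 'a \<Rightarrow> real" where
  "future_volume M m p = - measure m (I_plus M p)"

end

theory Submission
  imports Defs
begin

text \<open>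
  The relation \<open>\<lless>\<close> is generated by straight timelike segments in charts, because a curve with timelike
  one-sided derivatives stays, to first order, in the open cone of timelike directions. Hence
  \<open>I\<^sup>\<plusminus>(p)\<close> is open and accumulates at \<open>p\<close>. Displacing a causal curve along a timelike direction at an
  exponentially growing rate makes it timelike, as the metric is locally Lipschitz; this gives
  \<open>p \<lless> q \<le> r \<Longrightarrow> p \<lless> r\<close> and its dual.

  If \<open>k \<notin> closure (I\<^sup>-(p))\<close>, then \<open>k \<notin> J\<^sup>-(p)\<close>, and as \<open>J\<^sup>-(p)\<close> is closed, some \<open>x \<lless> k\<close> is not in
  \<open>J\<^sup>-(p)\<close>. The open sets \<open>- J\<^sup>+(x)\<close> and \<open>I\<^sup>+(x)\<close> then separate \<open>p\<close> and \<open>k\<close> as outer continuity demands.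
  Continuity of the volume functions follows by dominated convergence. They are strictly monotone
  because \<open>I\<^sup>-(p)\<close> is the interior of its closure, so that \<open>I\<^sup>-(p) \<subset> I\<^sup>-(q)\<close> leaves room for a
  non-empty open set in \<open>I\<^sup>-(q) - I\<^sup>-(p)\<close>.
\<close>

section \<open>Maps of class \<open>C\<^sup>k\<close> along lines\<close>

lemma times_differentiable_on_cong:
  assumes "\<And>x. x \<in> S \<Longrightarrow> f x = g x"
  shows "times_differentiable_on n S f \<longleftrightarrow> times_differentiable_on n S g"
  using assms
proof (induction n arbitrary: f g)
  case 0
  then show ?case by (simp cong: continuous_on_cong)
next
  case (Suc n)
  have der: "(f has_derivative D) (at x within S) \<longleftrightarrow> (g has_derivative D) (at x within S)"
    if "x \<in> S" for x D
    using that Suc.prems by (metis has_derivative_transform)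
  then have "f differentiable (at x within S) \<longleftrightarrow> g differentiable (at x within S)"
    and "frechet_derivative f (at x within S) = frechet_derivative g (at x within S)"
    if "x \<in> S" for x
    using that by (simp_all add: differentiable_def frechet_derivative_def)
  then show ?case
    using Suc.IH[of "\<lambda>x. frechet_derivative f (at x within S) v"
        "\<lambda>x. frechet_derivative g (at x within S) v" for v] by simp
qed

text \<open>\<open>frechet_derivative\<close> selects a derivative by choice. At a point that is not
  isolated in \<open>S\<close>, the derivative of a function of one real variable is unique, so the
  selected one is determined by \<open>d\<close>.\<close>

lemma frechet_derivative_real_within:
  fixes f :: "real \<Rightarrow> 'c::real_normed_vector"
  assumes "(f has_vector_derivative d) (at s within S)" "at s within S \<noteq> bot"
  shows "frechet_derivative f (at s within S) t = t *\<^sub>R d"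
proof -
  let ?D = "frechet_derivative f (at s within S)"
  have D: "(f has_derivative ?D) (at s within S)"
    using assms(1) by (metis differentiableI_vector frechet_derivative_works)
  then have lin: "linear ?D"
    by (rule has_derivative_linear)
  have D_scale: "?D t = t *\<^sub>R ?D 1" for t
    using linear_scale[OF lin, of t 1] by simp
  then have "?D = (\<lambda>t. t *\<^sub>R ?D 1)" by blast
  with D have "(f has_vector_derivative ?D 1) (at s within S)"
    by (metis has_vector_derivative_def)
  then have "?D 1 = d"
    using vector_derivative_unique_within[OF assms(2) _ assms(1)] by blast
  then show ?thesis
    using D_scale by metis
qed

text \<open>The factor \<open>r\<close> is carried for the induction: the derivative of the
  composite in direction \<open>t\<close> has the same form, with \<open>t * r\<close> for
  \<open>r\<close> and the directional derivative of \<open>f\<close> along \<open>v\<close> for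
  \<open>f\<close>.\<close>

lemma times_differentiable_on_compose_line:
  fixes f :: "'c::real_normed_vector \<Rightarrow> 'd::real_normed_vector"
  assumes "open U" and "\<And>s. s \<in> S \<Longrightarrow> at s within S \<noteq> bot"
    and line: "\<And>s. s \<in> S \<Longrightarrow> x + (s - a) *\<^sub>R v \<in> U"
    and "times_differentiable_on n U f"
  shows "times_differentiable_on n S (\<lambda>s::real. r *\<^sub>R f (x + (s - a) *\<^sub>R v))"
  using assms(4)
proof (induction n arbitrary: f r)
  case 0
  have "continuous_on S (\<lambda>s. f (x + (s - a) *\<^sub>R v))"
    by (rule continuous_on_compose2[of U f]) (use 0 line in \<open>auto intro!: continuous_intros\<close>)
  then show ?case by (auto intro!: continuous_intros)
next
  case (Suc n)
  let ?g = "\<lambda>s. r *\<^sub>R f (x + (s - a) *\<^sub>R v)"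
  let ?f' = "\<lambda>y. frechet_derivative f (at y within U) v"
  have g: "(?g has_vector_derivative r *\<^sub>R ?f' (x + (s - a) *\<^sub>R v)) (at s within S)" if "s \<in> S" for s
  proof -
    let ?y = "x + (s - a) *\<^sub>R v"
    have "f differentiable (at ?y within U)"
      using Suc.prems line[OF that] by simp
    then have D: "(f has_derivative frechet_derivative f (at ?y within U)) (at ?y)"
      using frechet_derivative_works at_within_open[OF line[OF that] \<open>open U\<close>] by metis
    then have lin: "linear (frechet_derivative f (at ?y within U))"
      by (rule has_derivative_linear)
    have "((\<lambda>s. x + (s - a) *\<^sub>R v) has_derivative (\<lambda>t. t *\<^sub>R v)) (at s within S)"
      by (auto intro!: derivative_eq_intros)
    from has_derivative_compose[OF this D]
    have "((\<lambda>s. f (x + (s - a) *\<^sub>R v)) has_derivative (\<lambda>t. t *\<^sub>R ?f' ?y)) (at s within S)"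
      by (simp add: linear_scale[OF lin])
    from has_derivative_scaleR_right[OF this, of r] show ?thesis
      by (simp add: has_vector_derivative_def mult.commute)
  qed
  then have "?g differentiable (at s within S)" if "s \<in> S" for s
    using that by (blast intro: differentiableI_vector)
  moreover have "times_differentiable_on n S (\<lambda>s. frechet_derivative ?g (at s within S) t)" for t
  proof -
    have "times_differentiable_on n S (\<lambda>s. (t * r) *\<^sub>R ?f' (x + (s - a) *\<^sub>R v))"
      using Suc.prems by (intro Suc.IH) simp
    moreover have "frechet_derivative ?g (at s within S) t = (t * r) *\<^sub>R ?f' (x + (s - a) *\<^sub>R v)"
      if "s \<in> S" for s
      using frechet_derivative_real_within[OF g[OF that] assms(2)[OF that]] by simp
    ultimately show ?thesis
      by (subst times_differentiable_on_cong) auto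
  qed
  ultimately show ?case by simp
qed

lemma Ck_onD:
  assumes "Ck_on k S f" "1 \<le> k"
  shows "continuous_on S f" "\<And>x. x \<in> S \<Longrightarrow> f differentiable (at x within S)"
    "\<And>v. continuous_on S (\<lambda>x. frechet_derivative f (at x within S) v)"
proof -
  have "times_differentiable_on 0 S f" "times_differentiable_on (Suc 0) S f"
    using assms by (auto simp: Ck_on_def zero_enat_def[symmetric] one_enat_def[symmetric] simp flip: One_nat_def simp del: times_differentiable_on.simps)
  then show "continuous_on S f" "\<And>x. x \<in> S \<Longrightarrow> f differentiable (at x within S)"
    "\<And>v. continuous_on S (\<lambda>x. frechet_derivative f (at x within S) v)" by auto
qed

lemma Ck_on_compose_line:
  fixes f :: "'c::real_normed_vector \<Rightarrow> 'd::real_normed_vector"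
  assumes "open U" and "\<And>s. s \<in> S \<Longrightarrow> at s within S \<noteq> bot"
    and "\<And>s. s \<in> S \<Longrightarrow> x + (s - a) *\<^sub>R v \<in> U" and "Ck_on k U f"
  shows "Ck_on k S (\<lambda>s::real. f (x + (s - a) *\<^sub>R v))"
  using times_differentiable_on_compose_line[OF assms(1-3), of _ f 1] assms(4)
  by (simp add: Ck_on_def)

text \<open>The directional derivatives along \<open>Basis\<close> are continuous, hence bounded on
  the compact \<open>K\<close>. Their bounds add up to one for the operator norm, and convexity
  permits the mean value inequality.\<close>

lemma Ck_on_lipschitz:
  fixes f :: "'c::euclidean_space \<Rightarrow> 'd::real_normed_vector"
  assumes "Ck_on k U f" "1 \<le> k" "open U" and K: "compact K" "convex K" "K \<subseteq> U"
  obtains L where "\<And>x y. x \<in> K \<Longrightarrow> y \<in> K \<Longrightarrow> norm (f x - f y) \<le> L * norm (x - y)"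
proof -
  note C1 = Ck_onD[OF assms(1,2)]
  let ?D = "\<lambda>x. frechet_derivative f (at x within U)"
  have D: "(f has_derivative ?D x) (at x within K)" if "x \<in> K" for x
    using C1(2) frechet_derivative_works has_derivative_subset[OF _ K(3)] K(3) that by blast
  have "bounded ((\<lambda>x. ?D x v) ` K)" for v
    using C1(3) K by (meson compact_continuous_image compact_imp_bounded continuous_on_subset)
  then have "\<forall>v. \<exists>B. \<forall>x\<in>K. norm (?D x v) \<le> B"
    by (simp add: bounded_iff)
  then obtain B where B: "\<And>v x. x \<in> K \<Longrightarrow> norm (?D x v) \<le> B v" by metis
  have "onorm (?D x) \<le> (\<Sum>i\<in>Basis. B i)" if "x \<in> K" for x
    using onorm_componentwise[OF has_derivative_bounded_linear[OF D[OF that]]]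
      sum_mono[of Basis "\<lambda>i. norm (?D x i)" B] B[OF that] by (meson order_trans)
  then show ?thesis
    using differentiable_bound[OF K(2) D] that by blast
qed


section \<open>Relations along intervals\<close>

text \<open>Bisection (\<open>Bolzano\<close>) leaves only short intervals around a point
  \<open>x\<close>, and these are cut at \<open>x\<close>. The local hypothesis thus compares
  \<open>x\<close> with its neighbours only, which is what a derivative at the single point
  \<open>x\<close> can provide.\<close>

lemma interval_chain:
  fixes P :: "real \<Rightarrow> real \<Rightarrow> bool"
  assumes trans: "\<And>s t u. P s t \<Longrightarrow> P t u \<Longrightarrow> P s u"
    and loc: "\<And>x. x \<in> {a..b} \<Longrightarrow> \<exists>d>0. \<forall>t\<in>{a..b}.
      (x < t \<and> t < x + d \<longrightarrow> P x t) \<and> (t < x \<and> x - d < t \<longrightarrow> P t x)"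
    and "a \<le> s" "s < t" "t \<le> b"
  shows "P s t"
proof -
  \<comment> \<open>\<open>Bolzano\<close> also quantifies over degenerate intervals and, locally,
    over intervals that leave \<open>{a..b}\<close>; \<open>Q\<close> is vacuous on both.\<close>
  define Q where "Q u v \<longleftrightarrow> (a \<le> u \<and> u < v \<and> v \<le> b \<longrightarrow> P u v)" for u v
  have "s \<le> t" using assms(4) by simp
  then have "Q s t"
  proof (induction rule: Bolzano)
    case (trans u v w)
    then show ?case
      unfolding Q_def using assms(1) by (metis order.trans order_le_less)
  next
    case (local x)
    then obtain d where d: "d > 0" "\<And>t. t \<in> {a..b} \<Longrightarrow> x < t \<Longrightarrow> t < x + d \<Longrightarrow> P x t"
      "\<And>t. t \<in> {a..b} \<Longrightarrow> t < x \<Longrightarrow> x - d < t \<Longrightarrow> P t x"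
      using loc[of x] assms(3,5) by auto
    have "Q u v" if "u \<le> x" "x \<le> v" "v - u < d" for u v
    proof (cases "u = x \<or> v = x")
      case True
      then show ?thesis using d that unfolding Q_def by auto
    next
      case False
      then have "a \<le> u \<Longrightarrow> v \<le> b \<Longrightarrow> P u x \<and> P x v"
        using d that by auto
      then show ?thesis using assms(1) unfolding Q_def by blast
    qed
    then show ?case using d(1) by blast
  qed
  then show ?thesis using assms by (simp add: Q_def)
qed

lemma piecewise_chain:
  fixes P :: "real \<Rightarrow> real \<Rightarrow> bool"
  assumes trans: "\<And>s t u. P s t \<Longrightarrow> P t u \<Longrightarrow> P s u"
    and pieces: "\<And>i s t. i < N \<Longrightarrow> \<tau> i \<le> s \<Longrightarrow> s < t \<Longrightarrow> t \<le> \<tau> (Suc i) \<Longrightarrow> P s t"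
    and "\<tau> 0 \<le> s" "s < t" "t \<le> \<tau> N"
  shows "P s t"
  using assms(2-)
proof (induction N arbitrary: t)
  case (Suc N)
  have IH: "P s t" if "s < t" "t \<le> \<tau> N" for t
    using Suc.IH Suc.prems(1,2) that less_Suc_eq by blast
  consider "t \<le> \<tau> N" | "\<tau> N \<le> s" | "s < \<tau> N" "\<tau> N < t" by linarith
  then show ?case
  proof cases
    case 1
    then show ?thesis using IH Suc.prems by blast
  next
    case 2
    then show ?thesis using Suc.prems by blast
  next
    case 3
    then show ?thesis using trans[of s "\<tau> N" t] IH[of "\<tau> N"] Suc.prems(1)[of N "\<tau> N" t] Suc.prems(4) by simp
  qed
qed simp

text \<open>\<open>Ck_segment\<close> differentiates within the set \<open>T\<close> of parameters
  whose points lie in a chart domain, but \<open>velocity\<close> within the whole interval. As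
  \<open>T\<close> is relatively open in the interval, both derivatives use the same filter.\<close>

lemma at_within_interval_preimage:
  fixes \<gamma> :: "real \<Rightarrow> 'c::topological_space"
  assumes "a < b" "continuous_on {a..b} \<gamma>" "open W"
  defines "T \<equiv> {s \<in> {a..b}. \<gamma> s \<in> W}"
  assumes "s \<in> T"
  shows "at s within T = at s within {a..b}" "at s within T \<noteq> bot" "\<exists>d>0. {a..b} \<inter> ball s d \<subseteq> T"
proof -
  obtain A where A: "open A" "A \<inter> {a..b} = \<gamma> -` W \<inter> {a..b}"
    using iffD1[OF continuous_on_open_invariant assms(2), rule_format, OF assms(3)] by blast
  then have T: "T = {a..b} \<inter> A" by (auto simp: T_def set_eq_iff)
  show "\<exists>d>0. {a..b} \<inter> ball s d \<subseteq> T"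
    using A(1) assms(5) unfolding T open_contains_ball by (meson IntD2 Int_mono order_refl)
  show at: "at s within T = at s within {a..b}"
    using A(1) assms(5) by (intro at_within_nhd[of s A]) (auto simp: T)
  show "at s within T \<noteq> bot"
    using assms(1,5) by (simp add: at trivial_limit_within islimpt_Icc) (simp add: T)
qed


section \<open>Polygonal timelike curves\<close>

text \<open>Two strict inequalities, hence an open condition on point and vector; see
  \<open>future_timelike_stable\<close>.\<close>

definition future_timelike ::
  "('a, 'b::euclidean_space) lorentz_structure \<Rightarrow> ('a, 'b) chart \<Rightarrow> 'b \<Rightarrow> 'b \<Rightarrow> bool" where
  "future_timelike M c x v \<longleftrightarrow> metric M c x v v < 0 \<and> metric M c x v (orientation M c x) < 0"

text \<open>Stated for coordinates, so that segments can be cut and perturbed in the model vector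
  space. The velocity \<open>y - x\<close> is constant along the segment, but the cone varies, hence
  the condition at every \<open>t\<close>.\<close>

definition chart_step ::
  "('a, 'b::euclidean_space) lorentz_structure \<Rightarrow> ('a, 'b) chart \<Rightarrow> 'b \<Rightarrow> 'b \<Rightarrow> bool" where
  "chart_step M c x y \<longleftrightarrow> (\<forall>t\<in>{0..1}. x + t *\<^sub>R (y - x) \<in> chart_range c \<and>
     future_timelike M c (x + t *\<^sub>R (y - x)) (y - x))"

definition timelike_step ::
  "('a, 'b::euclidean_space) lorentz_structure \<Rightarrow> 'a \<Rightarrow> 'a \<Rightarrow> bool" where
  "timelike_step M p q \<longleftrightarrow> (\<exists>c\<in>atlas M. p \<in> chart_dom c \<and> q \<in> chart_dom c \<and>
     chart_step M c (chart_map c p) (chart_map c q))"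

text \<open>Chains of steps can be concatenated and perturbed without regard to the smoothness of
  curves. That they yield the same relation as timelike curves is
  \<open>chron_less_eq_prec\<close>.\<close>

abbreviation prec ::
  "('a, 'b::euclidean_space) lorentz_structure \<Rightarrow> 'a \<Rightarrow> 'a \<Rightarrow> bool" where
  "prec M \<equiv> (timelike_step M)\<^sup>+\<^sup>+"

locale lorentz_spacetime =
  fixes M :: "('a::{t2_space, second_countable_topology}, 'b::euclidean_space) lorentz_structure"
  assumes spacetime: "spacetime M"
begin

section \<open>Charts, metric and time orientation in coordinates\<close>

lemma smoothness_ge: "1 \<le> smoothness M"
  using spacetime by (simp add: spacetime_def)

lemma is_chart: "c \<in> atlas M \<Longrightarrow> is_chart c"
  using spacetime by (simp add: spacetime_def Ck_atlas_def)

lemma chart_cover: "\<exists>c\<in>atlas M. p \<in> chart_dom c"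
  using spacetime by (auto simp: spacetime_def Ck_atlas_def)

lemma
  assumes "c \<in> atlas M"
  shows open_chart_dom: "open (chart_dom c)"
    and open_chart_range: "open (chart_range c)"
    and continuous_chart_map: "continuous_on (chart_dom c) (chart_map c)"
    and continuous_chart_inv: "continuous_on (chart_range c) (chart_inv c)"
    and chart_inv_map: "p \<in> chart_dom c \<Longrightarrow> chart_inv c (chart_map c p) = p"
    and chart_map_inv: "x \<in> chart_range c \<Longrightarrow> chart_map c (chart_inv c x) = x"
    and chart_inv_in_dom: "x \<in> chart_range c \<Longrightarrow> chart_inv c x \<in> chart_dom c"
  using is_chart[OF assms] by (auto simp: is_chart_def homeomorphism_def)

lemma chart_map_in_range: "p \<in> chart_dom c \<Longrightarrow> chart_map c p \<in> chart_range c"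
  by (simp add: chart_range_def)

lemma
  assumes "c \<in> atlas M" "x \<in> chart_range c"
  shows bilinear_metric: "bilinear (metric M c x)"
    and metric_commute: "metric M c x u v = metric M c x v u"
    and orientation_timelike: "metric M c x (orientation M c x) (orientation M c x) < 0"
  using spacetime assms
  by (auto simp: spacetime_def Ck_lorentzian_metric_def lorentzian_form_def time_orientation_def)

lemma Ck_metric: "c \<in> atlas M \<Longrightarrow> Ck_on (smoothness M) (chart_range c) (\<lambda>x. metric M c x u v)"
  using spacetime by (simp add: spacetime_def Ck_lorentzian_metric_def)

lemma continuous_orientation: "c \<in> atlas M \<Longrightarrow> continuous_on (chart_range c) (orientation M c)"
  using spacetime by (simp add: spacetime_def time_orientation_def)

text \<open>Regularity of the metric is given for fixed vectors only. The expansion into components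
  extends it to varying vectors in \<open>continuous_metric\<close> and
  \<open>metric_lipschitz\<close>.\<close>

lemma metric_expand:
  assumes "c \<in> atlas M" "x \<in> chart_range c"
  shows "metric M c x u v = (\<Sum>i\<in>Basis. \<Sum>j\<in>Basis. (u \<bullet> i) * (v \<bullet> j) * metric M c x i j)"
proof -
  note bil = bilinear_metric[OF assms]
  have "metric M c x u v = metric M c x (\<Sum>i\<in>Basis. (u \<bullet> i) *\<^sub>R i) (\<Sum>j\<in>Basis. (v \<bullet> j) *\<^sub>R j)"
    by (simp only: euclidean_representation)
  also have "\<dots> = (\<Sum>(i, j)\<in>Basis \<times> Basis. metric M c x ((u \<bullet> i) *\<^sub>R i) ((v \<bullet> j) *\<^sub>R j))"
    by (rule bilinear_sum[OF bil])
  also have "\<dots> = (\<Sum>i\<in>Basis. \<Sum>j\<in>Basis. (u \<bullet> i) * (v \<bullet> j) * metric M c x i j)"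
    by (simp add: sum.cartesian_product[symmetric] bilinear_lmul[OF bil] bilinear_rmul[OF bil] ac_simps)
  finally show ?thesis .
qed

lemma continuous_metric:
  assumes c: "c \<in> atlas M" and y: "continuous_on A y" "\<And>a. a \<in> A \<Longrightarrow> y a \<in> chart_range c"
    and "continuous_on A u" "continuous_on A v"
  shows "continuous_on A (\<lambda>a. metric M c (y a) (u a) (v a))"
proof -
  have "continuous_on A (\<lambda>a. metric M c (y a) i j)" for i j
    using continuous_on_compose2[OF Ck_onD(1)[OF Ck_metric[OF c] smoothness_ge] y(1)] y(2) by blast
  then have "continuous_on A (\<lambda>a. \<Sum>i\<in>Basis. \<Sum>j\<in>Basis. (u a \<bullet> i) * (v a \<bullet> j) * metric M c (y a) i j)"
    using assms(4,5) by (intro continuous_intros)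
  then show ?thesis
    by (rule continuous_on_eq) (simp add: metric_expand[OF c y(2), symmetric])
qed

section \<open>The open future cone and the chords of timelike curves\<close>

lemma future_timelike_scaleR:
  assumes "c \<in> atlas M" "x \<in> chart_range c" "future_timelike M c x v" "r > 0"
  shows "future_timelike M c x (r *\<^sub>R v)"
  using assms bilinear_metric[OF assms(1,2)]
  by (simp add: future_timelike_def bilinear_lmul bilinear_rmul mult_pos_neg)

text \<open>The two inequalities are strict and jointly continuous in point and vector, so they
  persist on a product of balls; one radius serves both factors.\<close>

lemma future_timelike_stable:
  assumes c: "c \<in> atlas M" and x: "x \<in> chart_range c" and v: "future_timelike M c x v"
  obtains r where "r > 0" "ball x r \<subseteq> chart_range c"
    "\<forall>y\<in>ball x r. \<forall>w\<in>ball v r. future_timelike M c y w"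
proof -
  let ?D = "chart_range c \<times> (UNIV :: 'b set)"
  let ?f = "\<lambda>(y, w). metric M c y w w" and ?g = "\<lambda>(y, w). metric M c y w (orientation M c y)"
  have "continuous_on ?D (\<lambda>z. orientation M c (fst z))"
    by (rule continuous_on_compose2[OF continuous_orientation[OF c]]) (auto intro!: continuous_intros)
  then have "continuous_on ?D ?f" "continuous_on ?D ?g"
    unfolding case_prod_beta by (auto intro!: continuous_metric[OF c] continuous_intros)
  then have "open (?D \<inter> ?f -` {..<0})" "open (?D \<inter> ?g -` {..<0})"
    using open_chart_range[OF c] by (auto intro!: continuous_open_preimage open_Times)
  then have "open ((?D \<inter> ?f -` {..<0}) \<inter> (?D \<inter> ?g -` {..<0}))" (is "open ?W")
    by (rule open_Int)
  moreover have "(x, v) \<in> ?W" using x v by (simp add: future_timelike_def)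
  ultimately obtain A B where AB: "open A" "open B" "x \<in> A" "v \<in> B" "A \<times> B \<subseteq> ?W"
    by (auto elim!: open_prod_elim)
  obtain r1 where r1: "r1 > 0" "ball x r1 \<subseteq> A" using AB open_contains_ball by blast
  obtain r2 where r2: "r2 > 0" "ball v r2 \<subseteq> B" using AB open_contains_ball by blast
  show ?thesis
  proof
    show "min r1 r2 > 0" using r1 r2 by simp
    have "y \<in> chart_range c \<and> future_timelike M c y w"
      if "y \<in> ball x (min r1 r2)" "w \<in> ball v (min r1 r2)" for y w
    proof -
      have "(y, w) \<in> ?W" using that r1 r2 AB(5) by (auto simp: subset_iff)
      then show ?thesis by (auto simp: future_timelike_def)
    qed
    moreover have "v \<in> ball v (min r1 r2)" using r1 r2 by simp
    ultimately show "ball x (min r1 r2) \<subseteq> chart_range c"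
      "\<forall>y\<in>ball x (min r1 r2). \<forall>w\<in>ball v (min r1 r2). future_timelike M c y w"
      by blast+
  qed
qed

text \<open>The ball around \<open>x\<close> is convex and so contains the segment, whose velocity
  is a positive multiple of the cone vector \<open>w\<close>.\<close>

lemma chart_stepI:
  assumes c: "c \<in> atlas M" and ball: "ball x r \<subseteq> chart_range c"
    and cone: "\<forall>y\<in>ball x r. \<forall>w\<in>ball v r. future_timelike M c y w"
    and "y \<in> ball x r" "y + d *\<^sub>R w \<in> ball x r" "d > 0" "w \<in> ball v r"
  shows "chart_step M c y (y + d *\<^sub>R w)"
  unfolding chart_step_def
proof
  fix t :: real assume t: "t \<in> {0..1}"
  have "(1 - t) *\<^sub>R y + t *\<^sub>R (y + d *\<^sub>R w) \<in> ball x r"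
    using t assms(4,5) by (intro convexD[OF convex_ball]) auto
  then have "y + t *\<^sub>R (y + d *\<^sub>R w - y) \<in> ball x r"
    by (simp add: algebra_simps)
  then show "y + t *\<^sub>R (y + d *\<^sub>R w - y) \<in> chart_range c \<and>
      future_timelike M c (y + t *\<^sub>R (y + d *\<^sub>R w - y)) (y + d *\<^sub>R w - y)"
    using ball cone assms(7) future_timelike_scaleR[OF c] assms(6) by (auto simp: subset_iff)
qed

lemma chart_step_in_range:
  assumes "chart_step M c x y"
  shows "x \<in> chart_range c" "y \<in> chart_range c"
proof -
  have "x + t *\<^sub>R (y - x) \<in> chart_range c" if "t \<in> {0..1}" for t
    using assms that by (simp add: chart_step_def)
  from this[of 0] this[of 1] show "x \<in> chart_range c" "y \<in> chart_range c" by simp_all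
qed

lemma chart_step_imp_timelike_step:
  assumes "c \<in> atlas M" "chart_step M c x y"
  shows "timelike_step M (chart_inv c x) (chart_inv c y)"
  using assms chart_step_in_range[OF assms(2)]
  by (auto simp: timelike_step_def chart_inv_in_dom chart_map_inv intro!: bexI[of _ c])

text \<open>The difference quotients of \<open>\<beta>\<close> at \<open>s\<close> tend to
  \<open>v\<close> and so enter the ball of future timelike vectors around \<open>v\<close>; hence
  the chords between \<open>\<beta> s\<close> and nearby points are timelike. As the derivative is
  taken within \<open>T\<close>, end points of intervals are covered.\<close>

lemma timelike_curve_chart_step:
  assumes c: "c \<in> atlas M" and x: "\<beta> s \<in> chart_range c"
    and der: "(\<beta> has_vector_derivative v) (at s within T)" and v: "future_timelike M c (\<beta> s) v"
  obtains d where "d > 0"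
    "\<And>t. t \<in> T \<Longrightarrow> s < t \<Longrightarrow> t < s + d \<Longrightarrow> chart_step M c (\<beta> s) (\<beta> t)"
    "\<And>t. t \<in> T \<Longrightarrow> t < s \<Longrightarrow> s - d < t \<Longrightarrow> chart_step M c (\<beta> t) (\<beta> s)"
proof -
  obtain r where r: "r > 0" "ball (\<beta> s) r \<subseteq> chart_range c"
    "\<forall>y\<in>ball (\<beta> s) r. \<forall>w\<in>ball v r. future_timelike M c y w"
    using future_timelike_stable[OF c x v] by metis
  obtain d1 where d1: "d1 > 0"
    "\<And>t. t \<in> T \<Longrightarrow> \<bar>t - s\<bar> < d1 \<Longrightarrow> norm (\<beta> t - \<beta> s - (t - s) *\<^sub>R v) \<le> r / 2 * \<bar>t - s\<bar>"
    using der r(1) unfolding has_vector_derivative_def has_derivative_within_alt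
    by (metis half_gt_zero real_norm_def)
  \<comment> \<open>The second bound keeps \<open>\<beta> t\<close> in the ball of radius
    \<open>r\<close>, since its increment is at most
    \<open>\<bar>t - s\<bar> * (norm v + r)\<close>.\<close>
  define d where "d = min d1 (r / (norm v + r))"
  have d: "d > 0" using d1 r(1) by (simp add: d_def add_nonneg_pos)
  have quot: "(1 / (t - s)) *\<^sub>R (\<beta> t - \<beta> s) \<in> ball v r" (is "?w \<in> _") and near: "\<beta> t \<in> ball (\<beta> s) r"
    if t: "t \<in> T" "t \<noteq> s" "\<bar>t - s\<bar> < d" for t
  proof -
    have bd: "norm (\<beta> t - \<beta> s - (t - s) *\<^sub>R v) \<le> r / 2 * \<bar>t - s\<bar>"
      using d1(2)[OF t(1)] t(3) by (simp add: d_def)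
    have "?w - v = (1 / (t - s)) *\<^sub>R (\<beta> t - \<beta> s - (t - s) *\<^sub>R v)"
      using t(2) by (simp add: scaleR_diff_right)
    then have "norm (?w - v) = norm (\<beta> t - \<beta> s - (t - s) *\<^sub>R v) / \<bar>t - s\<bar>"
      by (simp add: abs_inverse divide_inverse)
    also have "\<dots> \<le> r / 2" using bd t(2) by (simp add: field_simps)
    finally have w: "norm (?w - v) \<le> r / 2" .
    then show "?w \<in> ball v r" using r(1) by (simp add: dist_norm norm_minus_commute)
    have "norm ?w \<le> norm v + r" using norm_triangle_sub[of ?w v] w r(1) by linarith
    moreover have "\<beta> t - \<beta> s = (t - s) *\<^sub>R ?w" using t(2) by simp
    ultimately have "norm (\<beta> t - \<beta> s) \<le> \<bar>t - s\<bar> * (norm v + r)"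
      by (metis abs_ge_zero mult_left_mono norm_scaleR)
    also have "\<dots> < r / (norm v + r) * (norm v + r)"
      using t(3) r(1) by (intro mult_strict_right_mono) (auto simp: d_def add_nonneg_pos)
    also have "\<dots> = r" using r(1) by (simp add: add_nonneg_pos less_imp_neq[THEN not_sym])
    finally show "\<beta> t \<in> ball (\<beta> s) r" by (simp add: dist_norm norm_minus_commute)
  qed
  have "chart_step M c (\<beta> s) (\<beta> t)" if "t \<in> T" "s < t" "t < s + d" for t
    using chart_stepI[OF c r(2,3), of "\<beta> s" "t - s" "(1 / (t - s)) *\<^sub>R (\<beta> t - \<beta> s)"]
      quot[of t] near[of t] that r(1) by auto
  moreover have "chart_step M c (\<beta> t) (\<beta> s)" if "t \<in> T" "t < s" "s - d < t" for t
  proof -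
    \<comment> \<open>For \<open>t < s\<close> the chord runs from \<open>\<beta> t\<close> to
      \<open>\<beta> s\<close>. Both signs change, so it is a positive multiple of the same
      difference quotient.\<close>
    have "(s - t) * (1 / (t - s)) = -1" using that(2) by (simp add: field_simps)
    then have "\<beta> t + (s - t) *\<^sub>R ((1 / (t - s)) *\<^sub>R (\<beta> t - \<beta> s)) = \<beta> s"
      unfolding scaleR_scaleR by simp
    then show ?thesis
      using chart_stepI[OF c r(2,3), of "\<beta> t" "s - t" "(1 / (t - s)) *\<^sub>R (\<beta> t - \<beta> s)"]
        quot[of t] near[of t] that r(1) by auto
  qed
  ultimately show ?thesis using d that by blast
qed

lemma timelike_curve_prec:
  assumes c: "c \<in> atlas M" and "s < s'"
    and \<beta>: "\<And>t. t \<in> {s..s'} \<Longrightarrow> \<beta> t \<in> chart_range c"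
      "\<And>t. t \<in> {s..s'} \<Longrightarrow> (\<beta> has_vector_derivative \<beta>' t) (at t within {s..s'})"
      "\<And>t. t \<in> {s..s'} \<Longrightarrow> future_timelike M c (\<beta> t) (\<beta>' t)"
  shows "prec M (chart_inv c (\<beta> s)) (chart_inv c (\<beta> s'))"
proof (rule interval_chain[where a = s and b = s' and P = "\<lambda>s s'. prec M (chart_inv c (\<beta> s)) (chart_inv c (\<beta> s'))"])
  fix x assume x: "x \<in> {s..s'}"
  show "\<exists>d>0. \<forall>t\<in>{s..s'}. (x < t \<and> t < x + d \<longrightarrow> prec M (chart_inv c (\<beta> x)) (chart_inv c (\<beta> t))) \<and>
      (t < x \<and> x - d < t \<longrightarrow> prec M (chart_inv c (\<beta> t)) (chart_inv c (\<beta> x)))"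
    by (rule timelike_curve_chart_step[OF c \<beta>[OF x]])
      (use chart_step_imp_timelike_step[OF c] in blast)
qed (use \<open>s < s'\<close> in auto)

text \<open>The components are C^1, hence Lipschitz on a compact ball, and the form is quadratic in
  \<open>w\<close>. This is the error estimate for the displacement of causal curves.\<close>

lemma metric_lipschitz:
  assumes c: "c \<in> atlas M" and x: "x \<in> chart_range c"
  obtains r L where "r > 0" "L \<ge> 0" "cball x r \<subseteq> chart_range c"
    "\<And>y z w. y \<in> cball x r \<Longrightarrow> z \<in> cball x r \<Longrightarrow>
       \<bar>metric M c y w w - metric M c z w w\<bar> \<le> L * norm (y - z) * (norm w)\<^sup>2"
proof -
  obtain r where r: "r > 0" "cball x r \<subseteq> chart_range c"
    using open_chart_range[OF c] x open_contains_cball by blast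
  have "\<exists>L. \<forall>y\<in>cball x r. \<forall>z\<in>cball x r. \<bar>metric M c y i j - metric M c z i j\<bar> \<le> L * norm (y - z)" for i j
    using Ck_on_lipschitz[OF Ck_metric[OF c] smoothness_ge open_chart_range[OF c] compact_cball
        convex_cball r(2)] unfolding real_norm_def by metis
  then obtain L where L: "\<And>i j y z. y \<in> cball x r \<Longrightarrow> z \<in> cball x r \<Longrightarrow>
      \<bar>metric M c y i j - metric M c z i j\<bar> \<le> L i j * norm (y - z)" by metis
  define L' where "L' = (\<Sum>i\<in>Basis. \<Sum>j\<in>Basis. \<bar>L i j\<bar>)"
  have "\<bar>metric M c y w w - metric M c z w w\<bar> \<le> L' * norm (y - z) * (norm w)\<^sup>2"
    if yz: "y \<in> cball x r" "z \<in> cball x r" for y z w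
  proof -
    have "metric M c y w w - metric M c z w w =
        (\<Sum>i\<in>Basis. \<Sum>j\<in>Basis. (w \<bullet> i) * (w \<bullet> j) * (metric M c y i j - metric M c z i j))"
      using yz r(2) by (simp add: metric_expand[OF c, of y w w] metric_expand[OF c, of z w w]
          subset_iff sum_subtractf right_diff_distrib)
    also have "\<bar>\<dots>\<bar> \<le> (\<Sum>i\<in>Basis. \<Sum>j\<in>Basis. \<bar>(w \<bullet> i) * (w \<bullet> j) * (metric M c y i j - metric M c z i j)\<bar>)"
      by (rule order_trans[OF sum_abs]) (intro sum_mono sum_abs)
    also have "\<dots> \<le> (\<Sum>i\<in>Basis. \<Sum>j\<in>Basis. \<bar>L i j\<bar> * norm (y - z) * (norm w)\<^sup>2)"
    proof (intro sum_mono)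
      fix i j :: 'b assume "i \<in> Basis" "j \<in> Basis"
      then have "\<bar>w \<bullet> i\<bar> * \<bar>w \<bullet> j\<bar> \<le> norm w * norm w"
        by (intro mult_mono) (auto simp: Basis_le_norm)
      moreover have "\<bar>metric M c y i j - metric M c z i j\<bar> \<le> \<bar>L i j\<bar> * norm (y - z)"
        using L[OF yz, of i j] by (meson abs_ge_self mult_right_mono norm_ge_zero order_trans)
      ultimately have "\<bar>w \<bullet> i\<bar> * \<bar>w \<bullet> j\<bar> * \<bar>metric M c y i j - metric M c z i j\<bar>
          \<le> (norm w * norm w) * (\<bar>L i j\<bar> * norm (y - z))"
        by (rule mult_mono) auto
      then show "\<bar>(w \<bullet> i) * (w \<bullet> j) * (metric M c y i j - metric M c z i j)\<bar> \<le> \<bar>L i j\<bar> * norm (y - z) * (norm w)\<^sup>2"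
        by (simp add: abs_mult power2_eq_square mult_ac)
    qed
    also have "\<dots> = L' * norm (y - z) * (norm w)\<^sup>2"
      by (simp add: L'_def sum_distrib_right)
    finally show ?thesis .
  qed
  moreover have "L' \<ge> 0" by (simp add: L'_def sum_nonneg)
  ultimately show ?thesis using that r by blast
qed

section \<open>Openness of the polygonal relation and accumulation at the base point\<close>

lemma chart_step_sub:
  assumes c: "c \<in> atlas M" and "chart_step M c x y" "0 \<le> s" "s < t" "t \<le> 1"
  shows "chart_step M c (x + s *\<^sub>R (y - x)) (x + t *\<^sub>R (y - x))"
  unfolding chart_step_def
proof
  fix u :: real assume u: "u \<in> {0..1}"
  have "s + u * (t - s) \<in> {0..1}"
  proof -
    have "u * (t - s) \<le> 1 * (t - s)" "0 \<le> u * (t - s)"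
      using u assms(4) by (auto intro!: mult_right_mono)
    then show ?thesis using assms(3,5) by auto
  qed
  then have *: "x + (s + u * (t - s)) *\<^sub>R (y - x) \<in> chart_range c"
     "future_timelike M c (x + (s + u * (t - s)) *\<^sub>R (y - x)) (y - x)"
    using assms(2) by (auto simp: chart_step_def)
  have eq: "x + t *\<^sub>R (y - x) - (x + s *\<^sub>R (y - x)) = (t - s) *\<^sub>R (y - x)"
    "x + s *\<^sub>R (y - x) + u *\<^sub>R ((t - s) *\<^sub>R (y - x)) = x + (s + u * (t - s)) *\<^sub>R (y - x)"
    by (simp_all add: algebra_simps)
  show "x + s *\<^sub>R (y - x) + u *\<^sub>R (x + t *\<^sub>R (y - x) - (x + s *\<^sub>R (y - x))) \<in> chart_range c \<and>
      future_timelike M c (x + s *\<^sub>R (y - x) + u *\<^sub>R (x + t *\<^sub>R (y - x) - (x + s *\<^sub>R (y - x))))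
        (x + t *\<^sub>R (y - x) - (x + s *\<^sub>R (y - x)))"
    unfolding eq using * assms(4) future_timelike_scaleR[OF c] by simp
qed

text \<open>If \<open>u\<close> is within \<open>d * r\<close> of \<open>x\<close>, then the vectors
  from \<open>x - d *\<^sub>R v\<close> to \<open>u\<close> and from \<open>u\<close> to
  \<open>x + d *\<^sub>R v\<close>, divided by \<open>d\<close>, are within \<open>r\<close> of
  \<open>v\<close> and therefore future timelike.\<close>

lemma chart_step_nbhd:
  assumes c: "c \<in> atlas M" and x: "x \<in> chart_range c" and v: "future_timelike M c x v"
  obtains d0 where "d0 > 0" "\<And>d. 0 < d \<Longrightarrow> d < d0 \<Longrightarrow> \<exists>r>0. \<forall>u\<in>ball x r.
    chart_step M c (x - d *\<^sub>R v) u \<and> chart_step M c u (x + d *\<^sub>R v)"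
proof -
  obtain r where r: "r > 0" "ball x r \<subseteq> chart_range c"
    "\<forall>y\<in>ball x r. \<forall>w\<in>ball v r. future_timelike M c y w"
    using future_timelike_stable[OF c x v] by metis
  \<comment> \<open>The quotient keeps \<open>x - d *\<^sub>R v\<close> and
    \<open>x + d *\<^sub>R v\<close> in the ball of radius \<open>r\<close>; \<open>d < 1\<close>
    does so for the points within \<open>d * r\<close> of \<open>x\<close>.\<close>
  define d0 where "d0 = min 1 (r / (norm v + 1))"
  have d0: "d0 > 0" using r(1) by (simp add: d0_def add_nonneg_pos)
  have "chart_step M c (x - d *\<^sub>R v) u \<and> chart_step M c u (x + d *\<^sub>R v)"
    if d: "0 < d" "d < d0" and u: "u \<in> ball x (d * r)" for d u
  proof -
    have "d < r / (norm v + 1)" "d < 1" using d by (auto simp: d0_def)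
    then have "d * (norm v + 1) < r" by (metis add_nonneg_pos norm_ge_zero pos_less_divide_eq zero_less_one)
    then have dv: "d * norm v < r" using d(1) by (simp add: algebra_simps)
    have "norm (u - x) < d * r" using u by (simp add: dist_norm norm_minus_commute)
    moreover have "d * r < r" using \<open>d < 1\<close> r(1) by simp
    ultimately have "u \<in> ball x r" by (simp add: dist_norm norm_minus_commute)
    have *: "norm ((1 / d) *\<^sub>R (u - x)) < r"
      using \<open>norm (u - x) < d * r\<close> d(1) by (simp add: pos_divide_less_eq mult.commute)
    have "x - d *\<^sub>R v + d *\<^sub>R (v + (1 / d) *\<^sub>R (u - x)) = u" "u + d *\<^sub>R (v - (1 / d) *\<^sub>R (u - x)) = x + d *\<^sub>R v"
      using d(1) by (simp_all add: algebra_simps)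
    moreover have "v + (1 / d) *\<^sub>R (u - x) \<in> ball v r" "v - (1 / d) *\<^sub>R (u - x) \<in> ball v r"
      using * by (simp_all add: dist_norm norm_minus_commute)
    moreover have "x - d *\<^sub>R v \<in> ball x r" "x + d *\<^sub>R v \<in> ball x r"
      using dv d(1) by (simp_all add: dist_norm)
    ultimately show ?thesis
      using chart_stepI[OF c r(2,3), of "x - d *\<^sub>R v" d "v + (1 / d) *\<^sub>R (u - x)"]
        chart_stepI[OF c r(2,3), of u d "v - (1 / d) *\<^sub>R (u - x)"] \<open>u \<in> ball x r\<close> d(1) by simp
  qed
  then show ?thesis
    using that[OF d0] r(1) by (metis mult_pos_pos)
qed

lemma chart_ball_nbhd:
  assumes "c \<in> atlas M" "p \<in> chart_dom c" "r > 0"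
  obtains U where "open U" "p \<in> U" "U \<subseteq> chart_dom c" "\<And>u. u \<in> U \<Longrightarrow> chart_map c u \<in> ball (chart_map c p) r"
proof
  let ?U = "chart_dom c \<inter> chart_map c -` ball (chart_map c p) r"
  show "open ?U"
    using continuous_open_preimage[OF continuous_chart_map[OF assms(1)] open_chart_dom[OF assms(1)] open_ball] .
qed (use assms in auto)

text \<open>The segment is shortened at one end by the fraction \<open>d < 1\<close>, and
  \<open>chart_step_nbhd\<close> joins a whole neighbourhood of that end point to the remaining
  segment.\<close>

lemma timelike_step_open:
  assumes "timelike_step M p q"
  obtains U V where "open U" "p \<in> U" "open V" "q \<in> V" "\<And>u. u \<in> U \<Longrightarrow> prec M u q" "\<And>v. v \<in> V \<Longrightarrow> prec M p v"
proof -
  obtain c where c: "c \<in> atlas M" and p: "p \<in> chart_dom c" and q: "q \<in> chart_dom c"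
    and pq: "chart_step M c (chart_map c p) (chart_map c q)"
    using assms by (auto simp: timelike_step_def)
  let ?x = "chart_map c p" and ?y = "chart_map c q"
  note xy = chart_step_in_range[OF pq]
  have "?x + t *\<^sub>R (?y - ?x) \<in> chart_range c \<and> future_timelike M c (?x + t *\<^sub>R (?y - ?x)) (?y - ?x)"
    if "t \<in> {0..1}" for t using pq that by (simp add: chart_step_def)
  from this[of 0] this[of 1]
  have v: "future_timelike M c ?x (?y - ?x)" "future_timelike M c ?y (?y - ?x)" by simp_all
  obtain d1 where d1: "d1 > 0" "\<And>d. 0 < d \<Longrightarrow> d < d1 \<Longrightarrow> \<exists>r>0. \<forall>u\<in>ball ?x r.
    chart_step M c (?x - d *\<^sub>R (?y - ?x)) u \<and> chart_step M c u (?x + d *\<^sub>R (?y - ?x))"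
    using chart_step_nbhd[OF c xy(1) v(1)] by blast
  obtain d2 where d2: "d2 > 0" "\<And>d. 0 < d \<Longrightarrow> d < d2 \<Longrightarrow> \<exists>r>0. \<forall>u\<in>ball ?y r.
    chart_step M c (?y - d *\<^sub>R (?y - ?x)) u \<and> chart_step M c u (?y + d *\<^sub>R (?y - ?x))"
    using chart_step_nbhd[OF c xy(2) v(2)] by blast
  define d where "d = min (min d1 d2) 1 / 2"
  have d: "0 < d" "d < d1" "d < d2" "d < 1" using d1(1) d2(1) by (auto simp: d_def)
  obtain r1 where r1: "r1 > 0" "\<And>u. u \<in> ball ?x r1 \<Longrightarrow> chart_step M c u (?x + d *\<^sub>R (?y - ?x))"
    using d1(2)[of d] d by blast
  obtain r2 where r2: "r2 > 0" "\<And>u. u \<in> ball ?y r2 \<Longrightarrow> chart_step M c (?y - d *\<^sub>R (?y - ?x)) u"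
    using d2(2)[of d] d by blast
  have "?x + 1 *\<^sub>R (?y - ?x) = ?y" "?x + (1 - d) *\<^sub>R (?y - ?x) = ?y - d *\<^sub>R (?y - ?x)"
    "?x + 0 *\<^sub>R (?y - ?x) = ?x"
    by (simp_all add: algebra_simps)
  then have *: "chart_step M c (?x + d *\<^sub>R (?y - ?x)) ?y" "chart_step M c ?x (?y - d *\<^sub>R (?y - ?x))"
    using chart_step_sub[OF c pq, of d 1] chart_step_sub[OF c pq, of 0 "1 - d"] d by simp_all
  have trans: "prec M (chart_inv c x1) (chart_inv c x3)"
    if "chart_step M c x1 x2" "chart_step M c x2 x3" for x1 x2 x3
    using that chart_step_imp_timelike_step[OF c] by (meson tranclp.simps)
  obtain U where U: "open U" "p \<in> U" "U \<subseteq> chart_dom c" "\<And>u. u \<in> U \<Longrightarrow> chart_map c u \<in> ball ?x r1"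
    using chart_ball_nbhd[OF c p r1(1)] by metis
  obtain V where V: "open V" "q \<in> V" "V \<subseteq> chart_dom c" "\<And>u. u \<in> V \<Longrightarrow> chart_map c u \<in> ball ?y r2"
    using chart_ball_nbhd[OF c q r2(1)] by metis
  have "prec M u q" if "u \<in> U" for u
    using trans[OF r1(2)[OF U(4)[OF that]] *(1)] U(3) that q by (auto simp: chart_inv_map[OF c])
  moreover have "prec M p v" if "v \<in> V" for v
    using trans[OF *(2) r2(2)[OF V(4)[OF that]]] V(3) that p by (auto simp: chart_inv_map[OF c])
  ultimately show ?thesis using that U V by blast
qed

text \<open>Only the last step of a chain has to vary with its end point, and
  \<open>timelike_step_open\<close> provides the room.\<close>

lemma open_prec_future: "open {q. prec M p q}"
proof (subst open_subopen, clarify)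
  fix q assume "prec M p q"
  then obtain y where y: "timelike_step M y q" "y = p \<or> prec M p y"
    by (metis tranclp.cases)
  obtain V where "open V" "q \<in> V" "\<And>v. v \<in> V \<Longrightarrow> prec M y v"
    using timelike_step_open[OF y(1)] by metis
  then show "\<exists>T. open T \<and> q \<in> T \<and> T \<subseteq> {q. prec M p q}"
    using y(2) by (metis (no_types) mem_Collect_eq subsetI tranclp_trans)
qed

lemma open_prec_past: "open {p. prec M p q}"
proof (subst open_subopen, clarify)
  fix p assume "prec M p q"
  then obtain y where y: "timelike_step M p y" "y = q \<or> prec M y q"
    by (metis tranclpD rtranclpD)
  obtain U where "open U" "p \<in> U" "\<And>u. u \<in> U \<Longrightarrow> prec M u y"
    using timelike_step_open[OF y(1)] by metis
  then show "\<exists>T. open T \<and> p \<in> T \<and> T \<subseteq> {p. prec M p q}"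
    using y(2) by (metis (no_types) mem_Collect_eq subsetI tranclp_trans)
qed

lemma future_timelike_orientation:
  "c \<in> atlas M \<Longrightarrow> x \<in> chart_range c \<Longrightarrow> future_timelike M c x (orientation M c x)"
  by (simp add: future_timelike_def orientation_timelike)

text \<open>The coordinate line through \<open>p\<close> along the orientation vector lies in the
  future of \<open>p\<close> for small positive parameters and in its past for small negative
  ones.\<close>

lemma closure_prec: "p \<in> closure {q. prec M p q}" "p \<in> closure {q. prec M q p}"
proof -
  obtain c where c: "c \<in> atlas M" and p: "p \<in> chart_dom c" using chart_cover by blast
  let ?x = "chart_map c p"
  have x: "?x \<in> chart_range c" using p by (rule chart_map_in_range)
  let ?v = "orientation M c ?x"
  define \<beta> where "\<beta> t = ?x + t *\<^sub>R ?v" for t :: real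
  have "(\<beta> has_vector_derivative ?v) (at 0 within UNIV)"
    unfolding \<beta>_def by (auto intro!: derivative_eq_intros)
  then obtain d where d: "d > 0"
    "\<And>t. 0 < t \<Longrightarrow> t < d \<Longrightarrow> chart_step M c ?x (\<beta> t)"
    "\<And>t. t < 0 \<Longrightarrow> - d < t \<Longrightarrow> chart_step M c (\<beta> t) ?x"
    using timelike_curve_chart_step[OF c, of \<beta> 0 ?v UNIV] x future_timelike_orientation[OF c x]
    by (auto simp: \<beta>_def)
  \<comment> \<open>\<open>k\<close> is \<open>1\<close> for the future and \<open>-1\<close> for
    the past. The index \<open>n = 0\<close> is left out because it would give the parameter
    \<open>d\<close> itself, where no step is guaranteed; hence the shift to
    \<open>Suc n\<close>.\<close>
  have close: "p \<in> closure S" if S: "\<And>n::nat. n > 0 \<Longrightarrow> chart_inv c (\<beta> (k * (d / (real n + 1)))) \<in> S" for S and k :: real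
  proof -
    have "(\<lambda>n. \<beta> (k * (d / (real n + 1)))) \<longlonglongrightarrow> \<beta> (k * 0)"
      unfolding \<beta>_def by (intro tendsto_intros) real_asymp
    then have "(\<lambda>n. \<beta> (k * (d / (real n + 1)))) \<longlonglongrightarrow> ?x" by (simp add: \<beta>_def)
    then have "(\<lambda>n. chart_inv c (\<beta> (k * (d / (real n + 1))))) \<longlonglongrightarrow> chart_inv c ?x"
      using continuous_on_eq_continuous_at[OF open_chart_range[OF c]] continuous_chart_inv[OF c] x
        isCont_tendsto_compose by blast
    then have "(\<lambda>n. chart_inv c (\<beta> (k * (d / (real (Suc n) + 1))))) \<longlonglongrightarrow> p"
      using LIMSEQ_Suc chart_inv_map[OF c p] by fastforce
    moreover have "chart_inv c (\<beta> (k * (d / (real (Suc n) + 1)))) \<in> S" for n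
      by (rule S) simp
    ultimately show ?thesis
      unfolding closure_sequential
      by (intro exI[of _ "\<lambda>n. chart_inv c (\<beta> (k * (d / (real (Suc n) + 1))))"] conjI allI)
  qed
  have small: "0 < d / (real n + 1)" "d / (real n + 1) < d" if "n > 0" for n
    using that d(1) by (simp_all add: field_simps)
  have step: "prec M (chart_inv c x) (chart_inv c y)" if "chart_step M c x y" for x y
    using chart_step_imp_timelike_step[OF c that] by (rule tranclp.r_into_trancl)
  show "p \<in> closure {q. prec M p q}"
  proof (rule close[of 1], unfold mem_Collect_eq)
    fix n :: nat assume "n > 0"
    from step[OF d(2)[OF small[OF this]]]
    show "prec M p (chart_inv c (\<beta> (1 * (d / (real n + 1)))))"
      by (simp add: chart_inv_map[OF c p])
  qed
  show "p \<in> closure {q. prec M q p}"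
  proof (rule close[of "-1"], unfold mem_Collect_eq)
    fix n :: nat assume "n > 0"
    then have "- (d / (real n + 1)) < 0" "- d < - (d / (real n + 1))" using small[of n] by simp_all
    from step[OF d(3)[OF this]]
    show "prec M (chart_inv c (\<beta> (-1 * (d / (real n + 1))))) p"
      by (simp add: chart_inv_map[OF c p])
  qed
qed

section \<open>Push-up along causal curves\<close>

text \<open>
  A causal curve \<open>x\<close> becomes timelike when displaced by \<open>\<phi> X\<close>, where \<open>X\<close> is timelike: the change of
  the metric between \<open>x\<close> and \<open>x + \<phi> X\<close> is of order \<open>\<bar>\<phi>\<bar>\<close>, and it is compensated by the term
  \<open>2 \<phi>' g(x', X) < 0\<close> as soon as \<open>\<phi>'\<close> is a large multiple of \<open>\<bar>\<phi>\<bar>\<close>.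
\<close>

lemma causal_curve_displace:
  fixes T :: "real set"
  assumes c: "c \<in> atlas M" and s0: "s0 \<in> T"
    and x: "\<And>s. s \<in> T \<Longrightarrow> x s \<in> chart_range c"
      "\<And>s. s \<in> T \<Longrightarrow> (x has_vector_derivative V s) (at s within T)"
    and V: "continuous_on T V"
      "\<And>s. s \<in> T \<Longrightarrow> metric M c (x s) (V s) (V s) \<le> 0"
      "\<And>s. s \<in> T \<Longrightarrow> metric M c (x s) (V s) (orientation M c (x s)) < 0"
  obtains d r l where "d > 0" "r > 0" "l > 0"
    "\<And>s s' \<phi> \<phi>'. s < s' \<Longrightarrow> {s..s'} \<subseteq> T \<inter> ball s0 d \<Longrightarrow>
       (\<And>t. t \<in> {s..s'} \<Longrightarrow> (\<phi> has_real_derivative \<phi>' t) (at t within {s..s'}) \<and>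
          0 < \<phi>' t \<and> l * \<bar>\<phi> t\<bar> \<le> \<phi>' t \<and> \<bar>\<phi> t\<bar> < r) \<Longrightarrow>
       prec M (chart_inv c (x s + \<phi> s *\<^sub>R orientation M c (x s0)))
         (chart_inv c (x s' + \<phi> s' *\<^sub>R orientation M c (x s0)))"
proof -
  define X where "X = orientation M c (x s0)"
  let ?g = "metric M c"
  let ?D = "T \<times> chart_range c"
  have x0: "x s0 \<in> chart_range c" using x s0 by blast
  obtain R L where R: "R > 0" "L \<ge> 0" "cball (x s0) R \<subseteq> chart_range c"
    "\<And>y z w. y \<in> cball (x s0) R \<Longrightarrow> z \<in> cball (x s0) R \<Longrightarrow>
       \<bar>?g y w w - ?g z w w\<bar> \<le> L * norm (y - z) * (norm w)\<^sup>2"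
    using metric_lipschitz[OF c x0] by metis
  \<comment> \<open>Half of the value at \<open>s0\<close>, so that the strict bound by
    \<open>- k\<close> persists near \<open>(s0, x s0)\<close>.\<close>
  define k where "k = - ?g (x s0) (V s0) X / 2"
  have k: "k > 0" using V(3)[OF s0] by (simp add: k_def X_def)
  have X: "?g (x s0) X X < 0" using orientation_timelike[OF c x0] by (simp add: X_def)
  have conts: "continuous_on ?D (\<lambda>z. orientation M c (snd z))" "continuous_on ?D (\<lambda>z. V (fst z))"
    by (rule continuous_on_compose2[OF continuous_orientation[OF c]] continuous_on_compose2[OF V(1)];
        auto intro!: continuous_intros)+
  have z0: "(s0, x s0) \<in> ?D" using s0 x0 by simp
  have ev: "\<forall>\<^sub>F z in at (s0, x s0) within ?D. f z < b" if "continuous_on ?D f" "f (s0, x s0) < b"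
    for f :: "real \<times> 'b \<Rightarrow> real" and b
    using that z0 by (auto simp: continuous_on_def intro: order_tendstoD)
  \<comment> \<open>Parameter and point vary independently, because the metric will be evaluated at
    the displaced point while \<open>V\<close> is taken on the original curve.\<close>
  have "\<forall>\<^sub>F z in at (s0, x s0) within ?D. ?g (snd z) X X < 0 \<and>
      ?g (snd z) X (orientation M c (snd z)) < 0 \<and> ?g (snd z) (V (fst z)) X < - k \<and>
      ?g (snd z) (V (fst z)) (orientation M c (snd z)) < 0 \<and> norm (V (fst z)) < norm (V s0) + 1"
    using k X V(3)[OF s0]
    by (intro eventually_conj ev continuous_metric[OF c] continuous_intros conts)
      (auto simp: k_def X_def)
  then obtain e where e: "e > 0" and near0: "\<And>s y. s \<in> T \<Longrightarrow> y \<in> chart_range c \<Longrightarrow>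
      (s, y) \<noteq> (s0, x s0) \<Longrightarrow> dist (s, y) (s0, x s0) < e \<Longrightarrow>
      ?g y X X < 0 \<and> ?g y X (orientation M c y) < 0 \<and> ?g y (V s) X < - k \<and>
      ?g y (V s) (orientation M c y) < 0 \<and> norm (V s) < norm (V s0) + 1"
    unfolding eventually_at by force
  \<comment> \<open>The punctured neighbourhood filter omits the base point; it is added here, and
    the product distance is split into its factors.\<close>
  have near: "?g y X X < 0 \<and> ?g y X (orientation M c y) < 0 \<and> ?g y (V s) X < - k \<and>
      ?g y (V s) (orientation M c y) < 0 \<and> norm (V s) < norm (V s0) + 1"
    if "s \<in> T" "y \<in> chart_range c" "\<bar>s - s0\<bar> < e / 2" "dist y (x s0) < e / 2" for s y
  proof (cases "(s, y) = (s0, x s0)")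
    case True
    then show ?thesis using k X V(3)[OF s0] by (auto simp: k_def X_def)
  next
    case False
    have "dist (s, y) (s0, x s0) \<le> \<bar>s - s0\<bar> + dist y (x s0)"
      using sqrt_sum_squares_le_sum_abs[of "s - s0" "dist y (x s0)"]
      by (simp add: dist_Pair_Pair dist_real_def)
    then show ?thesis using near0[OF that(1,2) False] that(3,4) by simp
  qed
  define m where "m = min (e / 2) R"
  have m: "m > 0" using e R(1) by (simp add: m_def)
  have "continuous_on T x"
    using x(2) by (auto simp: continuous_on_eq_continuous_within
        intro: has_derivative_continuous simp: has_vector_derivative_def)
  then obtain d' where d': "d' > 0" "\<And>s. s \<in> T \<Longrightarrow> dist s s0 < d' \<Longrightarrow> dist (x s) (x s0) < m / 2"
    using s0 m unfolding continuous_on_iff by (metis half_gt_zero)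
  \<comment> \<open>\<open>B\<close> bounds the velocity near \<open>s0\<close>, \<open>r\<close>
    keeps the displacement shorter than \<open>m / 2\<close>, and \<open>l\<close> makes the
    Lipschitz error of the metric at most \<open>2 * k * \<phi>' t\<close>. The summand
    \<open>1\<close> ensures \<open>l > 0\<close>.\<close>
  define B where "B = norm (V s0) + 1"
  define d where "d = min d' (e / 2)"
  define r where "r = m / 2 / (norm X + 1)"
  define l where "l = L * norm X * B\<^sup>2 / (2 * k) + 1"
  have "d > 0" using d' e by (simp add: d_def)
  moreover have "r > 0" using m by (simp add: r_def add_nonneg_pos)
  moreover have l: "l > 0" using R(2) k by (simp add: l_def add_nonneg_pos)
  moreover have "prec M (chart_inv c (x s + \<phi> s *\<^sub>R X)) (chart_inv c (x s' + \<phi> s' *\<^sub>R X))"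
    if "s < s'" and sub: "{s..s'} \<subseteq> T \<inter> ball s0 d" and
      \<phi>: "\<And>t. t \<in> {s..s'} \<Longrightarrow> (\<phi> has_real_derivative \<phi>' t) (at t within {s..s'}) \<and>
          0 < \<phi>' t \<and> l * \<bar>\<phi> t\<bar> \<le> \<phi>' t \<and> \<bar>\<phi> t\<bar> < r"
    for s s' \<phi> \<phi>'
  proof -
    let ?\<beta> = "\<lambda>t. x t + \<phi> t *\<^sub>R X" and ?\<beta>' = "\<lambda>t. V t + \<phi>' t *\<^sub>R X"
    have 1: "?\<beta> t \<in> chart_range c" "(?\<beta> has_vector_derivative ?\<beta>' t) (at t within {s..s'})"
      "future_timelike M c (?\<beta> t) (?\<beta>' t)" if t: "t \<in> {s..s'}" for t
    proof -
      have tT: "t \<in> T" "dist t s0 < d'" "\<bar>t - s0\<bar> < e / 2"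
        using sub t by (auto simp: d_def dist_real_def subset_iff abs_minus_commute)
      have "norm (\<phi> t *\<^sub>R X) = \<bar>\<phi> t\<bar> * norm X" by simp
      also have "\<dots> \<le> r * norm X" using \<phi>[OF t] by (intro mult_right_mono) auto
      also have "\<dots> < m / 2"
        using m by (simp add: r_def divide_simps add_nonneg_pos add_nonneg_eq_0_iff)
      finally have "norm (\<phi> t *\<^sub>R X) < m / 2" .
      moreover have "norm (x t - x s0) < m / 2" using d'(2)[OF tT(1,2)] by (simp add: dist_norm)
      ultimately have dist: "dist (?\<beta> t) (x s0) < m"
        using norm_triangle_ineq[of "x t - x s0" "\<phi> t *\<^sub>R X"] by (simp add: dist_norm algebra_simps)
      then have cb: "?\<beta> t \<in> cball (x s0) R" "x t \<in> cball (x s0) R"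
        using d'(2)[OF tT(1,2)] m by (auto simp: m_def dist_commute)
      then show \<beta>: "?\<beta> t \<in> chart_range c" using R(3) by blast
      have "(x has_vector_derivative V t) (at t within {s..s'})"
        using x(2)[OF tT(1)] sub by (meson has_vector_derivative_within_subset le_inf_iff)
      then show "(?\<beta> has_vector_derivative ?\<beta>' t) (at t within {s..s'})"
        using \<phi>[OF t] by (auto intro!: derivative_eq_intros)
      have n: "?g (?\<beta> t) X X < 0" "?g (?\<beta> t) X (orientation M c (?\<beta> t)) < 0" "?g (?\<beta> t) (V t) X < - k"
        "?g (?\<beta> t) (V t) (orientation M c (?\<beta> t)) < 0" "norm (V t) < B"
        using near[OF tT(1) \<beta> tT(3)] dist by (auto simp: m_def B_def)
      have p: "\<phi>' t > 0" "l * \<bar>\<phi> t\<bar> \<le> \<phi>' t" using \<phi>[OF t] by auto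
      \<comment> \<open>\<open>V t\<close> is causal at \<open>x t\<close>, so its square at the
        displaced point is at most the Lipschitz error, hence at most
        \<open>2 * k * \<phi>' t\<close>. The mixed term, being less than
        \<open>- 2 * k * \<phi>' t\<close>, outweighs it.\<close>
      have "?g (?\<beta> t) (V t) (V t) \<le> L * norm (\<phi> t *\<^sub>R X) * (norm (V t))\<^sup>2"
        using R(4)[OF cb, of "V t"] V(2)[OF tT(1)] by simp
      also have "\<dots> \<le> L * norm (\<phi> t *\<^sub>R X) * B\<^sup>2"
        using n(5) R(2) by (intro mult_left_mono power_mono) auto
      also have "\<dots> = (L * norm X * B\<^sup>2 / (2 * k)) * \<bar>\<phi> t\<bar> * (2 * k)"
        using k by simp
      also have "\<dots> \<le> (l * \<bar>\<phi> t\<bar>) * (2 * k)"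
        using k by (intro mult_right_mono) (auto simp: l_def)
      also have "\<dots> \<le> \<phi>' t * (2 * k)"
        using p k by (intro mult_right_mono) auto
      finally have a: "?g (?\<beta> t) (V t) (V t) \<le> 2 * (\<phi>' t * k)" by simp
      have b: "\<phi>' t * ?g (?\<beta> t) (V t) X < \<phi>' t * (- k)"
        using n(3) p(1) by (rule mult_strict_left_mono)
      have "(\<phi>' t)\<^sup>2 * ?g (?\<beta> t) X X < 0" using n(1) p(1) by (simp add: mult_pos_neg)
      moreover have "?g (?\<beta> t) (?\<beta>' t) (?\<beta>' t) =
          ?g (?\<beta> t) (V t) (V t) + 2 * (\<phi>' t * ?g (?\<beta> t) (V t) X) + (\<phi>' t)\<^sup>2 * ?g (?\<beta> t) X X"
        using bilinear_metric[OF c \<beta>] metric_commute[OF c \<beta>, of X "V t"]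
        by (simp add: bilinear_ladd bilinear_radd bilinear_lmul bilinear_rmul power2_eq_square algebra_simps)
      ultimately have "?g (?\<beta> t) (?\<beta>' t) (?\<beta>' t) < 0" using a b by simp
      moreover have "?g (?\<beta> t) (?\<beta>' t) (orientation M c (?\<beta> t)) < 0"
        using bilinear_metric[OF c \<beta>] n(2,4) p(1)
        by (simp add: bilinear_ladd bilinear_lmul add_neg_neg mult_pos_neg)
      ultimately show "future_timelike M c (?\<beta> t) (?\<beta>' t)"
        by (simp add: future_timelike_def)
    qed
    show ?thesis by (rule timelike_curve_prec[OF c \<open>s < s'\<close> 1])
  qed
  ultimately show ?thesis using that unfolding X_def by blast
qed

section \<open>Push-up for pieces of causal curves and for whole curves\<close>

lemma Ck_segment_chart:
  assumes seg: "Ck_segment M \<gamma> a b" and c: "c \<in> atlas M"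
  defines "T \<equiv> {s \<in> {a..b}. \<gamma> s \<in> chart_dom c}"
  shows "\<And>s. s \<in> T \<Longrightarrow> \<exists>d>0. {a..b} \<inter> ball s d \<subseteq> T"
    and "\<And>s. s \<in> T \<Longrightarrow>
      ((chart_map c \<circ> \<gamma>) has_vector_derivative velocity c \<gamma> a b s) (at s within {a..b})"
    and "continuous_on T (velocity c \<gamma> a b)"
proof -
  let ?x = "chart_map c \<circ> \<gamma>"
  have "a < b" and cont: "continuous_on {a..b} \<gamma>" and Ck: "Ck_on (smoothness M) T ?x"
    using seg c by (auto simp: Ck_segment_def T_def)
  note T = at_within_interval_preimage[OF \<open>a < b\<close> cont open_chart_dom[OF c], folded T_def]
  note at = T(1) and nbot = T(2)
  show "\<exists>d>0. {a..b} \<inter> ball s d \<subseteq> T" if "s \<in> T" for s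
    using T(3)[OF that] .
  note C1 = Ck_onD[OF Ck smoothness_ge]
  show D: "(?x has_vector_derivative velocity c \<gamma> a b s) (at s within {a..b})" if "s \<in> T" for s
    using C1(2)[OF that] vector_derivative_works unfolding velocity_def at[OF that] by blast
  have "frechet_derivative ?x (at s within T) 1 = velocity c \<gamma> a b s" if "s \<in> T" for s
    using frechet_derivative_real_within[of ?x _ s T 1] D[OF that] nbot[OF that] at[OF that] by simp
  then show "continuous_on T (velocity c \<gamma> a b)"
    using C1(3)[of 1] by (simp cong: continuous_on_cong)
qed

text \<open>As \<open>e\<close> decreases to \<open>0\<close>, the displaced point tends to
  \<open>q\<close> and \<open>e * K\<close> to \<open>0\<close>, so one \<open>e\<close> both lands
  in the open set \<open>W\<close> and obeys the bound on displacements.\<close>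

lemma displacement_small:
  assumes c: "c \<in> atlas M" and "q \<in> chart_dom c" "open W" "q \<in> W" "r > 0"
  obtains e where "e > 0" "e * K < r" "chart_inv c (chart_map c q + (e * k) *\<^sub>R X) \<in> W"
proof -
  let ?f = "\<lambda>e. chart_inv c (chart_map c q + (e * k) *\<^sub>R X)"
  have "isCont (chart_inv c) (chart_map c q)"
    using continuous_on_eq_continuous_at[OF open_chart_range[OF c]] continuous_chart_inv[OF c]
      chart_map_in_range[OF assms(2)] by blast
  moreover have "((\<lambda>e. chart_map c q + (e * k) *\<^sub>R X) \<longlongrightarrow> chart_map c q + (0 * k) *\<^sub>R X) (at_right 0)"
    by (intro tendsto_intros)
  ultimately have "(?f \<longlongrightarrow> q) (at_right 0)"
    using isCont_tendsto_compose chart_inv_map[OF c assms(2)] by fastforce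
  then have "\<forall>\<^sub>F e in at_right 0. ?f e \<in> W"
    using assms(3,4) by (rule topological_tendstoD)
  moreover have "\<forall>\<^sub>F e in at_right 0. e * K < r"
  proof -
    have "((\<lambda>e. e * K) \<longlongrightarrow> 0 * K) (at_right 0)" by (intro tendsto_intros)
    then show ?thesis using assms(5) by (auto intro: order_tendstoD)
  qed
  moreover have "\<forall>\<^sub>F e in at_right 0. e > (0 :: real)" by (rule eventually_at_right_less)
  ultimately have "\<forall>\<^sub>F e in at_right 0. e > 0 \<and> e * K < r \<and> ?f e \<in> W"
    by eventually_elim simp
  then show ?thesis using that eventually_happens'[OF trivial_limit_at_right_real] by blast
qed

text \<open>Formulated as inclusions of chronological pasts and futures, the property is transitive
  and can be chained along a curve.\<close>

definition push_up :: "'a \<Rightarrow> 'a \<Rightarrow> bool" where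
  "push_up p q \<longleftrightarrow> (\<forall>x. prec M x p \<longrightarrow> prec M x q) \<and> (\<forall>x. prec M q x \<longrightarrow> prec M p x)"

text \<open>Near each parameter the curve is displaced by a function that vanishes at one end. The
  displaced point at the other end still lies in the given open chronological future or past, and
  the displaced curve is timelike. \<open>interval_chain\<close> extends this to the whole
  piece.\<close>

lemma causal_piece_push_up:
  assumes seg: "Ck_segment M \<gamma> a b"
    and causal: "\<And>s c. s \<in> {a..b} \<Longrightarrow> c \<in> atlas M \<Longrightarrow> \<gamma> s \<in> chart_dom c \<Longrightarrow>
      causal M c (chart_map c (\<gamma> s)) (velocity c \<gamma> a b s) \<and>
      future_directed M c (chart_map c (\<gamma> s)) (velocity c \<gamma> a b s)"
    and "a \<le> s" "s < t" "t \<le> b"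
  shows "push_up (\<gamma> s) (\<gamma> t)"
proof -
  have "\<exists>d>0. \<forall>t\<in>{a..b}. (s0 < t \<and> t < s0 + d \<longrightarrow> push_up (\<gamma> s0) (\<gamma> t)) \<and>
      (t < s0 \<and> s0 - d < t \<longrightarrow> push_up (\<gamma> t) (\<gamma> s0))" if s0: "s0 \<in> {a..b}" for s0
  proof -
    obtain c where c: "c \<in> atlas M" "\<gamma> s0 \<in> chart_dom c" using chart_cover by blast
    define T where "T = {s \<in> {a..b}. \<gamma> s \<in> chart_dom c}"
    note ch = Ck_segment_chart[OF seg c(1), folded T_def]
    let ?x = "chart_map c \<circ> \<gamma>" and ?V = "velocity c \<gamma> a b"
    define X where "X = orientation M c (?x s0)"
    have s0T: "s0 \<in> T" using s0 c by (simp add: T_def)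
    obtain d r l where d: "d > 0" "r > 0" "l > 0" and displace:
      "\<And>s s' \<phi> \<phi>'. s < s' \<Longrightarrow> {s..s'} \<subseteq> T \<inter> ball s0 d \<Longrightarrow>
         (\<And>t. t \<in> {s..s'} \<Longrightarrow> (\<phi> has_real_derivative \<phi>' t) (at t within {s..s'}) \<and>
            0 < \<phi>' t \<and> l * \<bar>\<phi> t\<bar> \<le> \<phi>' t \<and> \<bar>\<phi> t\<bar> < r) \<Longrightarrow>
         prec M (chart_inv c (?x s + \<phi> s *\<^sub>R X)) (chart_inv c (?x s' + \<phi> s' *\<^sub>R X))"
    proof (rule causal_curve_displace[OF c(1) s0T, of ?x ?V])
      fix s assume s: "s \<in> T"
      then have s': "s \<in> {a..b}" "\<gamma> s \<in> chart_dom c" by (auto simp: T_def)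
      show "?x s \<in> chart_range c" using s' by (simp add: chart_map_in_range)
      show "(?x has_vector_derivative ?V s) (at s within T)"
        using ch(2)[OF s] by (rule has_vector_derivative_within_subset) (auto simp: T_def)
      show "metric M c (?x s) (?V s) (?V s) \<le> 0" "metric M c (?x s) (?V s) (orientation M c (?x s)) < 0"
        using causal[OF s'(1) c(1) s'(2)] by (auto simp: causal_def future_directed_def)
    qed (use ch(3) that in \<open>auto simp: X_def\<close>)
    obtain d' where d': "d' > 0" "{a..b} \<inter> ball s0 d' \<subseteq> T" using ch(1)[OF s0T] by blast
    have push: "push_up (\<gamma> s) (\<gamma> s')" if "s < s'" and sub: "{s..s'} \<subseteq> {a..b} \<inter> ball s0 (min d d')" for s s'
    proof -
      have sub': "{s..s'} \<subseteq> T \<inter> ball s0 d" using sub d' by (auto simp: subset_iff)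
      then have dom: "\<gamma> s \<in> chart_dom c" "\<gamma> s' \<in> chart_dom c"
        using \<open>s < s'\<close> by (auto simp: T_def subset_iff)
      have inv: "chart_inv c (?x s + 0 *\<^sub>R X) = \<gamma> s" "chart_inv c (?x s' + 0 *\<^sub>R X) = \<gamma> s'"
        using dom by (simp_all add: chart_inv_map[OF c(1)])
      \<comment> \<open>The largest value of the exponentials below, so that
        \<open>e * K < r\<close> controls the displacement on the whole interval.\<close>
      define K where "K = exp (l * (s' - s))"
      have K: "exp (l * u) \<le> K" if "u \<le> s' - s" for u
        using that d(3) by (simp add: K_def)
      have "prec M p (\<gamma> s')" if p: "prec M p (\<gamma> s)" for p
      proof -
        obtain e where e: "e > 0" "e * K < r"
          "chart_inv c (?x s + (e * - (K - 1)) *\<^sub>R X) \<in> {q. prec M p q}"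
          using displacement_small[OF c(1) dom(1) open_prec_future, of p r K "- (K - 1)" X] p d(2)
          by auto
        \<comment> \<open>Starts on the past side and vanishes at \<open>s'\<close>, so the
          displaced curve ends at \<open>\<gamma> s'\<close>. The derivative exceeds
          \<open>l * \<bar>?\<phi> t\<bar>\<close> by \<open>e * l\<close>.\<close>
        let ?\<phi> = "\<lambda>t. - e * (exp (l * (s' - t)) - 1)" and ?\<phi>' = "\<lambda>t. e * l * exp (l * (s' - t))"
        have "prec M (chart_inv c (?x s + ?\<phi> s *\<^sub>R X)) (chart_inv c (?x s' + ?\<phi> s' *\<^sub>R X))"
        proof (rule displace[OF \<open>s < s'\<close> sub', of ?\<phi> ?\<phi>'])
          fix t assume t: "t \<in> {s..s'}"
          have E: "1 \<le> exp (l * (s' - t))" "exp (l * (s' - t)) \<le> K"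
            using t d(3) K[of "s' - t"] by auto
          have "(?\<phi> has_real_derivative ?\<phi>' t) (at t within {s..s'})"
            by (auto intro!: derivative_eq_intros)
          moreover have "0 < ?\<phi>' t" using e d by simp
          moreover have abs: "\<bar>?\<phi> t\<bar> = e * (exp (l * (s' - t)) - 1)" using E(1) e(1) by (simp add: abs_mult)
          moreover have "l * (e * (exp (l * (s' - t)) - 1)) \<le> ?\<phi>' t"
            using e(1) d(3) by (simp add: algebra_simps)
          moreover have "e * (exp (l * (s' - t)) - 1) \<le> e * K"
            using e(1) E by (intro mult_left_mono) auto
          ultimately show "(?\<phi> has_real_derivative ?\<phi>' t) (at t within {s..s'}) \<and> 0 < ?\<phi>' t \<and>
              l * \<bar>?\<phi> t\<bar> \<le> ?\<phi>' t \<and> \<bar>?\<phi> t\<bar> < r"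
            unfolding abs using e(2) by (intro conjI) (assumption | linarith)+
        qed
        moreover have "?\<phi> s = e * - (K - 1)" "?\<phi> s' = 0" by (simp_all add: K_def algebra_simps)
        ultimately have "prec M (chart_inv c (?x s + (e * - (K - 1)) *\<^sub>R X)) (\<gamma> s')"
          using inv(2) by (simp only:)
        then show ?thesis using e(3) tranclp_trans by (metis mem_Collect_eq)
      qed
      moreover have "prec M (\<gamma> s) p" if p: "prec M (\<gamma> s') p" for p
      proof -
        obtain e where e: "e > 0" "e * K < r"
          "chart_inv c (?x s' + (e * (K - 1)) *\<^sub>R X) \<in> {q. prec M q p}"
          using displacement_small[OF c(1) dom(2) open_prec_past, of p r K "K - 1" X] p d(2)
          by auto
        \<comment> \<open>The mirror image: the displacement vanishes at \<open>s\<close> and ends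
          on the future side.\<close>
        let ?\<phi> = "\<lambda>t. e * (exp (l * (t - s)) - 1)" and ?\<phi>' = "\<lambda>t. e * l * exp (l * (t - s))"
        have "prec M (chart_inv c (?x s + ?\<phi> s *\<^sub>R X)) (chart_inv c (?x s' + ?\<phi> s' *\<^sub>R X))"
        proof (rule displace[OF \<open>s < s'\<close> sub', of ?\<phi> ?\<phi>'])
          fix t assume t: "t \<in> {s..s'}"
          have E: "1 \<le> exp (l * (t - s))" "exp (l * (t - s)) \<le> K"
            using t d(3) K[of "t - s"] by auto
          have "(?\<phi> has_real_derivative ?\<phi>' t) (at t within {s..s'})"
            by (auto intro!: derivative_eq_intros)
          moreover have "0 < ?\<phi>' t" using e d by simp
          moreover have abs: "\<bar>?\<phi> t\<bar> = e * (exp (l * (t - s)) - 1)" using E(1) e(1) by (simp add: abs_mult)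
          moreover have "l * (e * (exp (l * (t - s)) - 1)) \<le> ?\<phi>' t"
            using e(1) d(3) by (simp add: algebra_simps)
          moreover have "e * (exp (l * (t - s)) - 1) \<le> e * K"
            using e(1) E by (intro mult_left_mono) auto
          ultimately show "(?\<phi> has_real_derivative ?\<phi>' t) (at t within {s..s'}) \<and> 0 < ?\<phi>' t \<and>
              l * \<bar>?\<phi> t\<bar> \<le> ?\<phi>' t \<and> \<bar>?\<phi> t\<bar> < r"
            unfolding abs using e(2) by (intro conjI) (assumption | linarith)+
        qed
        moreover have "?\<phi> s' = e * (K - 1)" "?\<phi> s = 0" by (simp_all add: K_def)
        ultimately have "prec M (\<gamma> s) (chart_inv c (?x s' + (e * (K - 1)) *\<^sub>R X))"
          using inv(1) by (simp only:)
        then show ?thesis using e(3) tranclp_trans by (metis mem_Collect_eq)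
      qed
      ultimately show ?thesis by (simp add: push_up_def)
    qed
    show ?thesis
    proof (intro exI[of _ "min d d'"] conjI ballI impI)
      show "min d d' > 0" using d d' by simp
      fix t assume t: "t \<in> {a..b}"
      show "push_up (\<gamma> s0) (\<gamma> t)" if "s0 < t \<and> t < s0 + min d d'"
        using that t s0 by (intro push) (auto simp: dist_real_def)
      show "push_up (\<gamma> t) (\<gamma> s0)" if "t < s0 \<and> s0 - min d d' < t"
        using that t s0 by (intro push) (auto simp: dist_real_def)
    qed
  qed
  moreover have "push_up p q \<Longrightarrow> push_up q z \<Longrightarrow> push_up p z" for p q z
    by (simp add: push_up_def)
  ultimately show ?thesis
    by (intro interval_chain[where P = "\<lambda>s t. push_up (\<gamma> s) (\<gamma> t)", OF _ _ assms(3-)]) blast+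
qed

lemma future_causal_curve_push_up:
  assumes "future_causal_curve M \<gamma> a b" "a \<le> s" "s < t" "t \<le> b"
  shows "push_up (\<gamma> s) (\<gamma> t)"
proof -
  obtain N \<tau> where N: "\<tau> 0 = a" "\<tau> N = b" and pieces: "\<And>i. i < N \<Longrightarrow> Ck_segment M \<gamma> (\<tau> i) (\<tau> (Suc i)) \<and>
     (\<forall>s\<in>{\<tau> i..\<tau> (Suc i)}. \<forall>c\<in>atlas M. \<gamma> s \<in> chart_dom c \<longrightarrow>
        causal M c (chart_map c (\<gamma> s)) (velocity c \<gamma> (\<tau> i) (\<tau> (Suc i)) s) \<and>
        future_directed M c (chart_map c (\<gamma> s)) (velocity c \<gamma> (\<tau> i) (\<tau> (Suc i)) s))"
    using assms(1) by (auto simp: future_curve_def)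
  show ?thesis
  proof (rule piecewise_chain[where P = "\<lambda>s t. push_up (\<gamma> s) (\<gamma> t)" and \<tau> = \<tau> and N = N])
    fix i s t assume "i < N" "\<tau> i \<le> s" "s < t" "t \<le> \<tau> (Suc i)"
    then show "push_up (\<gamma> s) (\<gamma> t)"
      using pieces[of i] causal_piece_push_up[of \<gamma> "\<tau> i" "\<tau> (Suc i)" s t] by auto
  qed (use N assms in \<open>auto simp: push_up_def\<close>)
qed

lemma future_curve_less:
  assumes "future_curve M P \<gamma> a b"
  shows "a < b"
proof -
  obtain N \<tau> where N: "0 < N" "\<tau> 0 = a" "\<tau> N = b" "\<forall>i<N. \<tau> i < \<tau> (Suc i)"
    using assms by (auto simp: future_curve_def Ck_segment_def)
  have "\<tau> 0 < \<tau> n" if "0 < n" "n \<le> N" for n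
    using that
  proof (induction n)
    case (Suc n)
    then have "\<tau> n < \<tau> (Suc n)" using N(4) by simp
    then show ?case using Suc by (cases "n = 0") auto
  qed simp
  from this[of N] show ?thesis using N by simp
qed

lemma causal_le_push_up: "causal_le M p q \<Longrightarrow> push_up p q"
  unfolding causal_le_def
proof (elim disjE exE conjE)
  fix \<gamma> a b assume \<gamma>: "future_causal_curve M \<gamma> a b" "\<gamma> a = p" "\<gamma> b = q"
  then show "push_up p q"
    using future_causal_curve_push_up[OF \<gamma>(1) order_refl future_curve_less[OF \<gamma>(1)] order_refl] by simp
qed (simp add: push_up_def)

text \<open>A causal velocity is non-zero, so to first order the curve leaves
  \<open>\<gamma> x\<close> on both sides of each parameter \<open>x\<close>. In a distinguishing
  spacetime this serves to exclude closed causal curves.\<close>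

lemma future_causal_curve_not_constant:
  assumes "future_causal_curve M \<gamma> a b" "a \<le> s" "s < t" "t \<le> b"
  shows "\<exists>u\<in>{s..t}. \<gamma> u \<noteq> \<gamma> s"
proof -
  obtain N \<tau> where N: "\<tau> 0 = a" "\<tau> N = b" and pieces: "\<And>i. i < N \<Longrightarrow> Ck_segment M \<gamma> (\<tau> i) (\<tau> (Suc i)) \<and>
     (\<forall>s\<in>{\<tau> i..\<tau> (Suc i)}. \<forall>c\<in>atlas M. \<gamma> s \<in> chart_dom c \<longrightarrow>
        causal M c (chart_map c (\<gamma> s)) (velocity c \<gamma> (\<tau> i) (\<tau> (Suc i)) s))"
    using assms(1) by (auto simp: future_curve_def)
  \<comment> \<open>With \<open>s < t\<close> included, \<open>P\<close> is transitive: a witness in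
    \<open>{s..t}\<close> remains one in the larger interval.\<close>
  define P where "P s t \<longleftrightarrow> s < t \<and> (\<exists>u\<in>{s..t}. \<gamma> u \<noteq> \<gamma> s)" for s t
  have trans: "P s t \<Longrightarrow> P t u \<Longrightarrow> P s u" for s t u
    unfolding P_def by (meson atLeastAtMost_iff less_trans order_trans less_imp_le)
  have piece: "P s t" if "i < N" "\<tau> i \<le> s" "s < t" "t \<le> \<tau> (Suc i)" for i s t
  proof (rule interval_chain[where P = P and a = "\<tau> i" and b = "\<tau> (Suc i)"])
    fix x assume x: "x \<in> {\<tau> i..\<tau> (Suc i)}"
    obtain c where c: "c \<in> atlas M" "\<gamma> x \<in> chart_dom c" using chart_cover by blast
    let ?v = "velocity c \<gamma> (\<tau> i) (\<tau> (Suc i)) x"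
    have "?v \<noteq> 0" using pieces[OF that(1)] x c by (auto simp: causal_def)
    moreover have "((chart_map c \<circ> \<gamma>) has_vector_derivative ?v) (at x within {\<tau> i..\<tau> (Suc i)})"
      using Ck_segment_chart(2)[OF _ c(1)] pieces[OF that(1)] x c by blast
    ultimately obtain d where d: "d > 0" "\<And>t. t \<in> {\<tau> i..\<tau> (Suc i)} \<Longrightarrow> \<bar>t - x\<bar> < d \<Longrightarrow>
        norm (chart_map c (\<gamma> t) - chart_map c (\<gamma> x) - (t - x) *\<^sub>R ?v) \<le> norm ?v / 2 * \<bar>t - x\<bar>"
      unfolding has_vector_derivative_def has_derivative_within_alt o_def
      by (metis half_gt_zero real_norm_def zero_less_norm_iff)
    have ne: "\<gamma> t \<noteq> \<gamma> x" if "t \<in> {\<tau> i..\<tau> (Suc i)}" "\<bar>t - x\<bar> < d" "t \<noteq> x" for t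
    proof
      assume "\<gamma> t = \<gamma> x"
      with d(2)[OF that(1,2)] have "\<bar>t - x\<bar> * norm ?v \<le> 0" by (simp add: mult.commute)
      then show False using that(3) \<open>?v \<noteq> 0\<close> by (simp add: mult_le_0_iff)
    qed
    show "\<exists>d>0. \<forall>t\<in>{\<tau> i..\<tau> (Suc i)}. (x < t \<and> t < x + d \<longrightarrow> P x t) \<and> (t < x \<and> x - d < t \<longrightarrow> P t x)"
    proof (intro exI[of _ d] conjI ballI impI d(1); elim conjE)
      fix t assume t: "t \<in> {\<tau> i..\<tau> (Suc i)}"
      show "P x t" if "x < t" "t < x + d"
        using ne[OF t] that unfolding P_def by (auto intro!: bexI[of _ t])
      show "P t x" if "t < x" "x - d < t"
        using ne[OF t] that unfolding P_def by (auto intro!: bexI[of _ x])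
    qed
  next
    show "P s t \<Longrightarrow> P t u \<Longrightarrow> P s u" for s t u by (rule trans)
  qed (use that in auto)
  have "P s t"
    using piecewise_chain[of P N \<tau> s t, OF trans piece] N assms by simp
  then show ?thesis by (simp add: P_def)
qed

section \<open>Timelike curves and polygons\<close>

text \<open>In a chart around each of its points the curve can be replaced by chords to nearby
  points; these are chained along each piece and then across the breaks.\<close>

lemma chron_less_imp_prec:
  assumes "chron_less M p q"
  shows "prec M p q"
proof -
  obtain \<gamma> a b where \<gamma>: "future_timelike_curve M \<gamma> a b" "\<gamma> a = p" "\<gamma> b = q"
    using assms by (auto simp: chron_less_def)
  then obtain N \<tau> where N: "\<tau> 0 = a" "\<tau> N = b" and pieces: "\<And>i. i < N \<Longrightarrow> Ck_segment M \<gamma> (\<tau> i) (\<tau> (Suc i)) \<and>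
     (\<forall>s\<in>{\<tau> i..\<tau> (Suc i)}. \<forall>c\<in>atlas M. \<gamma> s \<in> chart_dom c \<longrightarrow>
        timelike M c (chart_map c (\<gamma> s)) (velocity c \<gamma> (\<tau> i) (\<tau> (Suc i)) s) \<and>
        future_directed M c (chart_map c (\<gamma> s)) (velocity c \<gamma> (\<tau> i) (\<tau> (Suc i)) s))"
    by (auto simp: future_curve_def)
  have piece: "prec M (\<gamma> s) (\<gamma> t)" if i: "i < N" "\<tau> i \<le> s" "s < t" "t \<le> \<tau> (Suc i)" for i s t
  proof (rule interval_chain[where P = "\<lambda>s t. prec M (\<gamma> s) (\<gamma> t)" and a = "\<tau> i" and b = "\<tau> (Suc i)"])
    fix x assume x: "x \<in> {\<tau> i..\<tau> (Suc i)}"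
    obtain c where c: "c \<in> atlas M" "\<gamma> x \<in> chart_dom c" using chart_cover by blast
    note ch = Ck_segment_chart[OF _ c(1), of \<gamma> "\<tau> i" "\<tau> (Suc i)"]
    have seg: "Ck_segment M \<gamma> (\<tau> i) (\<tau> (Suc i))"
      and v: "future_timelike M c (chart_map c (\<gamma> x)) (velocity c \<gamma> (\<tau> i) (\<tau> (Suc i)) x)"
      using pieces[OF i(1)] x c by (auto simp: future_timelike_def timelike_def future_directed_def)
    have x': "x \<in> {s \<in> {\<tau> i..\<tau> (Suc i)}. \<gamma> s \<in> chart_dom c}" using x c by simp
    obtain d where d: "d > 0"
      "\<And>t. t \<in> {\<tau> i..\<tau> (Suc i)} \<Longrightarrow> x < t \<Longrightarrow> t < x + d \<Longrightarrow> chart_step M c (chart_map c (\<gamma> x)) (chart_map c (\<gamma> t))"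
      "\<And>t. t \<in> {\<tau> i..\<tau> (Suc i)} \<Longrightarrow> t < x \<Longrightarrow> x - d < t \<Longrightarrow> chart_step M c (chart_map c (\<gamma> t)) (chart_map c (\<gamma> x))"
      using timelike_curve_chart_step[OF c(1) _ ch(2)[OF seg x']] v chart_map_in_range[OF c(2)]
      unfolding o_def by metis
    obtain d' where d': "d' > 0" "\<And>t. t \<in> {\<tau> i..\<tau> (Suc i)} \<Longrightarrow> \<bar>t - x\<bar> < d' \<Longrightarrow> \<gamma> t \<in> chart_dom c"
      using ch(1)[OF seg x'] by (auto simp: subset_iff dist_real_def abs_minus_commute)
    show "\<exists>d>0. \<forall>t\<in>{\<tau> i..\<tau> (Suc i)}. (x < t \<and> t < x + d \<longrightarrow> prec M (\<gamma> x) (\<gamma> t)) \<and>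
        (t < x \<and> x - d < t \<longrightarrow> prec M (\<gamma> t) (\<gamma> x))"
    proof (intro exI[of _ "min d d'"] conjI ballI impI; (elim conjE)?)
      fix t assume t: "t \<in> {\<tau> i..\<tau> (Suc i)}"
      show "prec M (\<gamma> x) (\<gamma> t)" if "x < t" "t < x + min d d'"
        using d(2)[OF t] d'(2)[OF t] that c min_less_iff_conj[of "t - x" d d']
        by (intro tranclp.r_into_trancl) (auto simp: timelike_step_def)
      show "prec M (\<gamma> t) (\<gamma> x)" if "t < x" "x - min d d' < t"
      proof -
        have "x - d < t" "x - d' < t" using that(2) by auto
        then show ?thesis
          using d(3)[OF t] d'(2)[OF t] that c
          by (intro tranclp.r_into_trancl) (auto simp: timelike_step_def)
      qed
    qed (use d d' in simp)
  next
    show "prec M (\<gamma> s) (\<gamma> u)" if "prec M (\<gamma> s) (\<gamma> t)" "prec M (\<gamma> t) (\<gamma> u)" for s t u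
      using that by (rule tranclp_trans)
  qed (use i in auto)
  have "prec M (\<gamma> a) (\<gamma> b)"
    using piecewise_chain[where P = "\<lambda>s t. prec M (\<gamma> s) (\<gamma> t)" and \<tau> = \<tau> and N = N, of a b]
      piece N future_curve_less[OF \<gamma>(1)] tranclp_trans[of "timelike_step M"] by auto
  then show ?thesis using \<gamma> by simp
qed

section \<open>From straight segments to piecewise C^k timelike curves\<close>

lemma open_transition_dom:
  assumes "c \<in> atlas M" "d \<in> atlas M"
  shows "open (transition_dom c d)"
proof -
  have "transition_dom c d = chart_range c \<inter> chart_inv c -` chart_dom d"
    using chart_inv_map[OF assms(1)] chart_map_inv[OF assms(1)] chart_inv_in_dom[OF assms(1)]
    by (force simp: transition_dom_def chart_range_def)
  then show ?thesis
    using continuous_open_preimage[OF continuous_chart_inv[OF assms(1)] open_chart_range[OF assms(1)]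
        open_chart_dom[OF assms(2)]] by simp
qed

lemma Ck_transition:
  "c \<in> atlas M \<Longrightarrow> d \<in> atlas M \<Longrightarrow> Ck_on (smoothness M) (transition_dom c d) (transition c d)"
  using spacetime by (simp add: spacetime_def Ck_atlas_def)

text \<open>Metric and orientation transform with the derivative of the transition map. This is
  needed because \<open>future_curve\<close> tests velocities in every chart,
  \<open>chart_step\<close> in a single one.\<close>

lemma transition_timelike:
  assumes c: "c \<in> atlas M" and d: "d \<in> atlas M" and y: "y \<in> transition_dom c d"
    and v: "future_timelike M c y v"
  defines "w \<equiv> frechet_derivative (transition c d) (at y) v"
  shows "timelike M d (transition c d y) w" "future_directed M d (transition c d y) w"
proof -
  have g: "metric M c y u z = metric M d (transition c d y)
      (frechet_derivative (transition c d) (at y) u) (frechet_derivative (transition c d) (at y) z)" for u z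
    using spacetime c d y by (simp add: spacetime_def Ck_lorentzian_metric_def)
  have o: "orientation M d (transition c d y) = frechet_derivative (transition c d) (at y) (orientation M c y)"
    using spacetime c d y by (simp add: spacetime_def time_orientation_def)
  have "transition c d y \<in> chart_range d"
    using y chart_inv_map[OF c] by (auto simp: transition_dom_def transition_def chart_range_def)
  then have "w \<noteq> 0"
    using v bilinear_lzero[OF bilinear_metric[OF d]] unfolding future_timelike_def g w_def[symmetric] by auto
  then show "timelike M d (transition c d y) w" "future_directed M d (transition c d y) w"
    using v unfolding future_timelike_def g o[symmetric] w_def[symmetric]
    by (simp_all add: timelike_def future_directed_def)
qed

text \<open>Seen in a chart \<open>d\<close>, the segment is the transition map along an affine
  line, so it is C^k with the transformed velocity. \<open>\<gamma>\<close> is prescribed on a unit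
  interval only, so that the lemma applies to each piece of a concatenation.\<close>

lemma chart_step_segment:
  assumes c: "c \<in> atlas M" and xy: "chart_step M c x y"
    and \<gamma>: "\<And>t. t \<in> {a..a + 1} \<Longrightarrow> \<gamma> t = chart_inv c (x + (t - a) *\<^sub>R (y - x))"
  shows "Ck_segment M \<gamma> a (a + 1)"
    and "\<And>s d. s \<in> {a..a + 1} \<Longrightarrow> d \<in> atlas M \<Longrightarrow> \<gamma> s \<in> chart_dom d \<Longrightarrow>
      timelike M d (chart_map d (\<gamma> s)) (velocity d \<gamma> a (a + 1) s) \<and>
      future_directed M d (chart_map d (\<gamma> s)) (velocity d \<gamma> a (a + 1) s)"
proof -
  let ?l = "\<lambda>t. x + (t - a) *\<^sub>R (y - x)"
  have l: "?l t \<in> chart_range c" "future_timelike M c (?l t) (y - x)" if "t \<in> {a..a + 1}" for t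
    using xy that by (auto simp: chart_step_def)
  have cont: "continuous_on {a..a + 1} \<gamma>"
  proof (rule continuous_on_eq)
    show "continuous_on {a..a + 1} (\<lambda>t. chart_inv c (?l t))"
      by (rule continuous_on_compose2[OF continuous_chart_inv[OF c]]) (use l in \<open>auto intro!: continuous_intros\<close>)
  qed (simp add: \<gamma>)
  have tr: "?l s \<in> transition_dom c d" "(chart_map d \<circ> \<gamma>) s = transition c d (?l s)"
    if "s \<in> {s \<in> {a..a + 1}. \<gamma> s \<in> chart_dom d}" for s d
    using that l(1)[of s] \<gamma>[of s] chart_inv_in_dom[OF c] chart_map_inv[OF c]
    by (auto simp: transition_dom_def transition_def image_iff intro!: bexI[of _ "\<gamma> s"])
  note at = at_within_interval_preimage[of a "a + 1" \<gamma>, OF _ cont open_chart_dom]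
  have "Ck_on (smoothness M) {s \<in> {a..a + 1}. \<gamma> s \<in> chart_dom d} (chart_map d \<circ> \<gamma>)" if d: "d \<in> atlas M" for d
  proof -
    have "Ck_on (smoothness M) {s \<in> {a..a + 1}. \<gamma> s \<in> chart_dom d} (\<lambda>s. transition c d (?l s))"
      using at(2)[OF _ d] tr(1)
      by (intro Ck_on_compose_line[OF open_transition_dom[OF c d] _ _ Ck_transition[OF c d]]) auto
    moreover have "times_differentiable_on n {s \<in> {a..a + 1}. \<gamma> s \<in> chart_dom d} (chart_map d \<circ> \<gamma>) \<longleftrightarrow>
        times_differentiable_on n {s \<in> {a..a + 1}. \<gamma> s \<in> chart_dom d} (\<lambda>s. transition c d (?l s))" for n
      by (rule times_differentiable_on_cong) (rule tr(2))
    ultimately show ?thesis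
      by (simp only: Ck_on_def)
  qed
  then show "Ck_segment M \<gamma> a (a + 1)"
    using cont by (simp add: Ck_segment_def)
  fix s d assume s: "s \<in> {a..a + 1}" and d: "d \<in> atlas M" and sd: "\<gamma> s \<in> chart_dom d"
  let ?T = "{s \<in> {a..a + 1}. \<gamma> s \<in> chart_dom d}"
  let ?w = "frechet_derivative (transition c d) (at (?l s)) (y - x)"
  have sT: "s \<in> ?T" using s sd by simp
  have D: "(transition c d has_derivative frechet_derivative (transition c d) (at (?l s))) (at (?l s))"
    using Ck_onD(2)[OF Ck_transition[OF c d] smoothness_ge tr(1)[OF sT]]
      at_within_open[OF tr(1)[OF sT] open_transition_dom[OF c d]] frechet_derivative_works by metis
  have "(?l has_derivative (\<lambda>t. t *\<^sub>R (y - x))) (at s within ?T)"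
    by (auto intro!: derivative_eq_intros)
  from has_derivative_compose[OF this D]
  have "((\<lambda>s. transition c d (?l s)) has_vector_derivative ?w) (at s within ?T)"
    by (simp add: has_vector_derivative_def linear_scale[OF has_derivative_linear[OF D]])
  then have "((chart_map d \<circ> \<gamma>) has_vector_derivative ?w) (at s within ?T)"
    by (rule has_vector_derivative_transform[where g = "chart_map d \<circ> \<gamma>" and f = "\<lambda>s. transition c d (?l s)",
          OF sT tr(2), rotated])
  then have "((chart_map d \<circ> \<gamma>) has_vector_derivative ?w) (at s within {a..a + 1})"
    using at(1)[OF _ d sT] by simp
  then have "velocity d \<gamma> a (a + 1) s = ?w"
    unfolding velocity_def using s by (intro vector_derivative_within_closed_interval[of a "a + 1"]) auto
  then show "timelike M d (chart_map d (\<gamma> s)) (velocity d \<gamma> a (a + 1) s) \<and>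
      future_directed M d (chart_map d (\<gamma> s)) (velocity d \<gamma> a (a + 1) s)"
    using transition_timelike[OF c d tr(1)[OF sT] l(2)[OF s]] tr(2)[OF sT] by simp
qed

lemma prec_imp_chron_less:
  assumes "prec M p q"
  shows "chron_less M p q"
proof -
  obtain N f where N: "0 < N" "f 0 = p" "f N = q" "\<And>i. i < N \<Longrightarrow> timelike_step M (f i) (f (Suc i))"
    using assms by (auto simp: tranclp_power relpowp_fun_conv)
  then have "\<forall>i. \<exists>c. i < N \<longrightarrow> c \<in> atlas M \<and> f i \<in> chart_dom c \<and> f (Suc i) \<in> chart_dom c \<and>
      chart_step M c (chart_map c (f i)) (chart_map c (f (Suc i)))"
    unfolding timelike_step_def by blast
  then obtain c where c: "\<And>i. i < N \<Longrightarrow> c i \<in> atlas M" "\<And>i. i < N \<Longrightarrow> f i \<in> chart_dom (c i)"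
      "\<And>i. i < N \<Longrightarrow> f (Suc i) \<in> chart_dom (c i)"
      "\<And>i. i < N \<Longrightarrow> chart_step M (c i) (chart_map (c i) (f i)) (chart_map (c i) (f (Suc i)))"
    by metis
  define l where "l i t = chart_inv (c i)
      (chart_map (c i) (f i) + (t - real i) *\<^sub>R (chart_map (c i) (f (Suc i)) - chart_map (c i) (f i)))" for i t
  have ends: "l i (real i) = f i" "l i (real i + 1) = f (Suc i)" if "i < N" for i
    using c(1-3)[OF that] by (simp_all add: l_def chart_inv_map)
  \<comment> \<open>Step \<open>i\<close> is run through on \<open>[i, i + 1]\<close>. At
    \<open>t = N\<close> there is no further step, and the default value \<open>q\<close> is the
    required end point.\<close>
  define \<gamma> where "\<gamma> t = (let i = nat \<lfloor>t\<rfloor> in if i < N then l i t else q)" for t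
  \<comment> \<open>At the right end of the interval the floor selects the next step, or
    \<open>q\<close>, which begins where step \<open>i\<close> ends.\<close>
  have \<gamma>: "\<gamma> t = l i t" if i: "i < N" and t: "t \<in> {real i..real i + 1}" for i t
  proof (cases "t = real i + 1")
    case True
    then have "nat \<lfloor>t\<rfloor> = Suc i" by simp
    then show ?thesis
      using True N(3) i ends(2)[OF i] ends(1)[of "Suc i"]
      by (cases "Suc i < N") (auto simp: \<gamma>_def Let_def add.commute less_Suc_eq not_less_eq)
  next
    case False
    with t have "nat \<lfloor>t\<rfloor> = i" by (intro nat_eq_iff[THEN iffD2]) (auto simp: floor_eq_iff)
    then show ?thesis using i by (simp add: \<gamma>_def)
  qed
  have "future_timelike_curve M \<gamma> (real 0) (real N)"
    unfolding future_curve_def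
  proof (intro exI[of _ N] exI[of _ real] conjI allI impI)
    fix i assume i: "i < N"
    note seg = chart_step_segment[OF c(1)[OF i] c(4)[OF i], of "real i" \<gamma>]
    show "Ck_segment M \<gamma> (real i) (real (Suc i))"
      using seg(1) \<gamma>[OF i] by (simp add: l_def add.commute)
    show "\<forall>s\<in>{real i..real (Suc i)}. \<forall>d\<in>atlas M. \<gamma> s \<in> chart_dom d \<longrightarrow>
        timelike M d (chart_map d (\<gamma> s)) (velocity d \<gamma> (real i) (real (Suc i)) s) \<and>
        future_directed M d (chart_map d (\<gamma> s)) (velocity d \<gamma> (real i) (real (Suc i)) s)"
      using seg(2) \<gamma>[OF i] by (simp add: l_def add.commute)
  qed (use N in auto)
  moreover have "\<gamma> (real 0) = p"
    using \<gamma>[of 0 0] ends(1)[of 0] N(1,2) by simp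
  moreover have "\<gamma> (real N) = q" by (simp add: \<gamma>_def)
  ultimately show ?thesis unfolding chron_less_def by blast
qed

lemma chron_less_eq_prec: "chron_less M = prec M"
  using chron_less_imp_prec prec_imp_chron_less by blast

lemma chron_less_imp_causal_le: "chron_less M p q \<Longrightarrow> causal_le M p q"
proof -
  assume "chron_less M p q"
  then obtain \<gamma> a b where "future_timelike_curve M \<gamma> a b" "\<gamma> a = p" "\<gamma> b = q"
    by (auto simp: chron_less_def)
  moreover from this(1) have "future_causal_curve M \<gamma> a b"
    unfolding future_curve_def
    by (elim ex_forward) (auto simp: timelike_def causal_def less_imp_le)
  ultimately show ?thesis unfolding causal_le_def by blast
qed

end

section \<open>Outer continuity and volume functions\<close>

text \<open>\<open>R\<close> stands for the chronological and \<open>J\<close> for the causal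
  relation. They are kept abstract so that reversing both yields the statement for futures.\<close>

lemma outer_continuous_closed_order:
  fixes R J :: "'a::topological_space \<Rightarrow> 'a \<Rightarrow> bool"
  assumes closed: "\<And>p. closed {q. J p q}" "\<And>q. closed {p. J p q}"
    and "\<And>p. open {q. R p q}"
    and dense: "\<And>p. p \<in> closure {q. R q p}"
    and RJ: "\<And>p q. R p q \<Longrightarrow> J p q"
    and push: "\<And>p q z. R p q \<Longrightarrow> J q z \<Longrightarrow> R p z"
  shows "outer_continuous (\<lambda>p. {q. R q p})"
  unfolding outer_continuous_def
proof (intro allI impI, elim conjE)
  fix p K assume K: "compact K" "K \<subseteq> - closure {q. R q p}"
  have cl: "closure {q. R q p} \<subseteq> {q. J q p}" for p
    by (rule closure_minimal) (use RJ closed in auto)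
  have "\<exists>V W. open V \<and> open W \<and> p \<in> V \<and> k \<in> W \<and> (\<forall>q\<in>V. W \<inter> closure {x. R x q} = {})"
    if "k \<notin> closure {q. R q p}" for k
  proof -
    have "\<not> J k p"
    proof
      assume "J k p"
      then have "{q. R q k} \<subseteq> {q. R q p}" using push by blast
      then show False using dense[of k] closure_mono that by blast
    qed
    then have "k \<in> - {q. J q p} \<inter> closure {q. R q k}" using dense by simp
    then obtain x where x: "R x k" "\<not> J x p"
      using open_Int_closure_eq_empty[of "- {q. J q p}" "{q. R q k}"] closed(2)[of p]
      by (auto simp: open_Compl)
    \<comment> \<open>Such a \<open>w\<close> satisfies \<open>J w q\<close>, as pasts under
      \<open>J\<close> are closed; push-up then gives \<open>R x q\<close>, hence
      \<open>J x q\<close>.\<close>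
    have "False" if "\<not> J x q" "R x w" "w \<in> closure {y. R y q}" for q w
      using that cl push RJ by blast
    then show ?thesis
      using x assms(3) closed(1)
      by (intro exI[of _ "- {q. J x q}"] exI[of _ "{w. R x w}"]) (auto simp: open_Compl)
  qed
  then have "\<forall>k\<in>K. \<exists>V W. open V \<and> open W \<and> p \<in> V \<and> k \<in> W \<and> (\<forall>q\<in>V. W \<inter> closure {x. R x q} = {})"
    using K(2) by blast
  then obtain V W where VW: "\<And>k. k \<in> K \<Longrightarrow> open (V k) \<and> open (W k) \<and> p \<in> V k \<and> k \<in> W k \<and>
      (\<forall>q\<in>V k. W k \<inter> closure {x. R x q} = {})" by metis
  \<comment> \<open>Finitely many \<open>W k\<close> cover \<open>K\<close>, so the corresponding
    \<open>V k\<close> have an open intersection.\<close>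
  obtain C where C: "C \<subseteq> K" "finite C" "K \<subseteq> (\<Union>k\<in>C. W k)"
    by (rule compactE_image[OF K(1), of K W]) (use VW in auto)
  show "\<exists>U. open U \<and> p \<in> U \<and> (\<forall>q\<in>U. K \<subseteq> - closure {x. R x q})"
  proof (intro exI conjI ballI subsetI)
    show "open (\<Inter>k\<in>C. V k)" using C VW by (intro open_INT) auto
    show "p \<in> (\<Inter>k\<in>C. V k)" using C VW by auto
    fix q x assume "q \<in> (\<Inter>k\<in>C. V k)" "x \<in> K"
    then show "x \<in> - closure {x. R x q}" using C VW by blast
  qed
qed

section \<open>Continuity and strict monotonicity of volumes\<close>

text \<open>If \<open>x\<close> is interior to the closure, then so is some \<open>z\<close> with
  \<open>R x z\<close>. The open set of successors of \<open>x\<close> thus meets the closure of the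
  past of \<open>p\<close>, hence the past itself, and transitivity gives
  \<open>R x p\<close>.\<close>

lemma interior_closure_past:
  fixes R :: "'a::topological_space \<Rightarrow> 'a \<Rightarrow> bool"
  assumes "transp R" "\<And>p. open {q. R p q}" "\<And>p. open {q. R q p}" "\<And>p. p \<in> closure {q. R p q}"
  shows "interior (closure {q. R q p}) = {q. R q p}"
proof
  show "{q. R q p} \<subseteq> interior (closure {q. R q p})"
    using assms(3) by (simp add: interior_maximal closure_subset)
  show "interior (closure {q. R q p}) \<subseteq> {q. R q p}"
  proof
    fix x assume x: "x \<in> interior (closure {q. R q p})"
    then have "interior (closure {q. R q p}) \<inter> {z. R x z} \<noteq> {}"
      using open_Int_closure_eq_empty[of "interior (closure {q. R q p})" "{z. R x z}"] assms(4)[of x] by auto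
    then have "{z. R x z} \<inter> closure {q. R q p} \<noteq> {}"
      using interior_subset by blast
    then have "{z. R x z} \<inter> {q. R q p} \<noteq> {}"
      using open_Int_closure_eq_empty[OF assms(2)] by blast
    then show "x \<in> {q. R q p}" using assms(1) by (auto dest: transpD)
  qed
qed

lemma finite_borel_measure:
  fixes m :: "'a::topological_space measure"
  assumes "borel_or_completed m" "emeasure m UNIV < \<infinity>"
  shows "finite_measure m" "space m = UNIV" "sets borel \<subseteq> sets m"
proof -
  obtain m0 where m0: "sets m0 = sets borel" "m = m0 \<or> m = completion m0"
    using assms(1) by (auto simp: borel_or_completed_def)
  have "space m0 = UNIV" using sets_eq_imp_space_eq[OF m0(1)] by simp
  then show space: "space m = UNIV" using m0(2) by auto
  show "sets borel \<subseteq> sets m" using m0 by (auto intro: sets_completionI_sets)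
  show "finite_measure m" using assms(2) space by (intro finite_measureI) auto
qed

text \<open>Off the null frontier the indicators are eventually constant along a sequence: inside
  the past because successor sets are open, outside its closure by outer continuity for a one-point
  compact set. The constant \<open>1\<close> is integrable and dominates.\<close>

lemma measure_past_continuous:
  fixes R :: "'a::{t2_space, first_countable_topology} \<Rightarrow> 'a \<Rightarrow> bool"
  assumes "outer_continuous (\<lambda>p. {q. R q p})"
    and "\<And>p. open {q. R p q}" and past: "\<And>p. open {q. R q p}"
    and m: "borel_or_completed m" "emeasure m UNIV < \<infinity>"
    and null: "\<And>p. emeasure m (frontier {q. R q p}) = 0"
  shows "continuous_on UNIV (\<lambda>p. measure m {q. R q p})"
  unfolding continuous_on_eq_continuous_within
proof (intro ballI continuous_within_sequentiallyI)
  fix p and u :: "nat \<Rightarrow> 'a" assume u: "u \<longlonglongrightarrow> p"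
  interpret finite_measure m by (rule finite_borel_measure[OF m])
  note borel = finite_borel_measure(3)[OF m]
  have ind: "(indicator {q. R q z} :: 'a \<Rightarrow> real) \<in> borel_measurable m" for z
    using borel past by (intro borel_measurable_indicator) (auto dest: borel_open)
  have "(\<lambda>n. \<integral>x. indicator {q. R q (u n)} x \<partial>m) \<longlonglongrightarrow> (\<integral>x. indicator {q. R q p} x \<partial>m :: real)"
  proof (rule integral_dominated_convergence[where w = "\<lambda>_. 1"])
    show "AE x in m. (\<lambda>n. indicator {q. R q (u n)} x :: real) \<longlonglongrightarrow> indicator {q. R q p} x"
    proof (rule AE_I)
      show "emeasure m (frontier {q. R q p}) = 0" by (rule null)
      show "frontier {q. R q p} \<in> sets m" using borel by (auto intro: borel_closed frontier_closed)
      have "(\<lambda>n. indicator {q. R q (u n)} x :: real) \<longlonglongrightarrow> indicator {q. R q p} x"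
        if "x \<notin> frontier {q. R q p}" for x
      proof (rule tendsto_eventually, cases "R x p")
        case True
        then have "\<forall>\<^sub>F n in sequentially. u n \<in> {q. R x q}"
          using u assms(2) by (intro topological_tendstoD) auto
        then show "\<forall>\<^sub>F n in sequentially. indicator {q. R q (u n)} x = (indicator {q. R q p} x :: real)"
          by eventually_elim (use True in simp)
      next
        case False
        then have "x \<notin> closure {q. R q p}"
          using that past by (auto simp: frontier_def interior_open)
        then obtain U where U: "open U" "p \<in> U" "\<And>q. q \<in> U \<Longrightarrow> x \<notin> closure {y. R y q}"
          using assms(1)[unfolded outer_continuous_def, rule_format, of "{x}" p] by auto
        have "\<forall>\<^sub>F n in sequentially. u n \<in> U"
          by (rule topological_tendstoD[OF u U(1,2)])
        then show "\<forall>\<^sub>F n in sequentially. indicator {q. R q (u n)} x = (indicator {q. R q p} x :: real)"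
        proof eventually_elim
          case (elim n)
          then have "\<not> R x (u n)" using U(3)[OF elim] closure_subset[of "{y. R y (u n)}"] by blast
          then show ?case using False by simp
        qed
      qed
      then show "{x \<in> space m. \<not> (\<lambda>n. indicator {q. R q (u n)} x :: real) \<longlonglongrightarrow> indicator {q. R q p} x}
          \<subseteq> frontier {q. R q p}" by blast
    qed
  qed (simp_all add: ind)
  then show "(\<lambda>n. measure m {q. R q (u n)}) \<longlonglongrightarrow> measure m {q. R q p}"
    using finite_borel_measure(2)[OF m] by simp
qed

text \<open>If the open past of \<open>q\<close> lay in the closure of the past of \<open>p\<close>,
  it would lie in the interior of that closure, which is the past of \<open>p\<close> by
  \<open>interior_closure_past\<close>.\<close>

lemma measure_past_strict:
  fixes R :: "'a::topological_space \<Rightarrow> 'a \<Rightarrow> bool"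
  assumes "transp R" "\<And>p. open {q. R p q}" and past: "\<And>p. open {q. R q p}"
    and "\<And>p. p \<in> closure {q. R p q}"
    and m: "borel_or_completed m" "emeasure m UNIV < \<infinity>"
    and pos: "\<And>U. open U \<Longrightarrow> U \<noteq> {} \<Longrightarrow> 0 < emeasure m U"
    and less: "{x. R x p} \<subset> {x. R x q}"
  shows "measure m {x. R x p} < measure m {x. R x q}"
proof -
  interpret finite_measure m by (rule finite_borel_measure[OF m])
  have sets: "A \<in> sets m" if "open A" for A
    using finite_borel_measure(3)[OF m] that by (auto intro: borel_open)
  let ?U = "{x. R x q} - closure {x. R x p}"
  have U: "open ?U" using past by (intro open_Diff) auto
  have "?U \<noteq> {}"
  proof
    assume "?U = {}"
    then have "{x. R x q} \<subseteq> interior (closure {x. R x p})"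
      using past by (intro interior_maximal) auto
    then show False using less interior_closure_past[OF assms(1-4), of p] by blast
  qed
  then have "0 < emeasure m ?U" by (rule pos[OF U])
  then have "0 < measure m ?U" unfolding emeasure_eq_measure by simp
  moreover have "measure m ({x. R x p} \<union> ?U) = measure m {x. R x p} + measure m ?U"
    using closure_subset[of "{x. R x p}"] by (intro finite_measure_Union sets past U) blast
  moreover have "measure m ({x. R x p} \<union> ?U) \<le> measure m {x. R x q}"
    using less by (intro finite_measure_mono sets past) auto
  ultimately show ?thesis by linarith
qed

section \<open>Causal continuity and the volume time functions\<close>

theorem proposition9:
  fixes M :: "('a::{t2_space, second_countable_topology}, 'b::euclidean_space) lorentz_structure"
  assumes "spacetime M"
    and "causally_simple M"
  shows "causally_continuous M \<and>
    (\<forall>m. admissible_measure M m \<longrightarrow>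
       is_time_function M (past_volume M m) \<and> is_time_function M (future_volume M m))"
proof (intro conjI allI impI)
  interpret lorentz_spacetime M by unfold_locales (rule assms(1))
  let ?R = "chron_less M" and ?J = "causal_le M"
  have dist: "distinguishing M" and closed: "\<And>p. closed {q. ?J p q}" "\<And>q. closed {p. ?J p q}"
    using assms(2) by (auto simp: causally_simple_def J_plus_def J_minus_def)
  have trans: "transp ?R" "transp (\<lambda>p q. ?R q p)"
    by (auto simp: chron_less_eq_prec transp_def intro: tranclp_trans)
  have open_R: "open {q. ?R p q}" "open {q. ?R q p}" for p
    by (simp_all add: chron_less_eq_prec open_prec_future open_prec_past)
  have dense: "p \<in> closure {q. ?R p q}" "p \<in> closure {q. ?R q p}" for p
    by (simp_all add: chron_less_eq_prec closure_prec)
  have push: "?R p q \<Longrightarrow> ?J q z \<Longrightarrow> ?R p z" "?J p q \<Longrightarrow> ?R q z \<Longrightarrow> ?R p z" for p q z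
    using causal_le_push_up unfolding chron_less_eq_prec push_up_def by blast+
  \<comment> \<open>Reversing both relations exchanges past and future, so one abstract lemma gives
    both halves.\<close>
  have outer: "outer_continuous (\<lambda>p. {q. ?R q p})" "outer_continuous (\<lambda>p. {q. ?R p q})"
    using outer_continuous_closed_order[of ?J ?R] outer_continuous_closed_order[of "\<lambda>p q. ?J q p" "\<lambda>p q. ?R q p"]
      closed open_R dense chron_less_imp_causal_le push by blast+
  then show "causally_continuous M"
    using dist by (simp add: causally_continuous_def I_minus_def[abs_def] I_plus_def[abs_def])
  fix m assume "admissible_measure M m"
  then have m: "borel_or_completed m" "emeasure m UNIV < \<infinity>"
    and pos: "\<And>U. open U \<Longrightarrow> U \<noteq> {} \<Longrightarrow> 0 < emeasure m U"
    and null: "\<And>p. emeasure m (frontier {q. ?R q p}) = 0" "\<And>p. emeasure m (frontier {q. ?R p q}) = 0"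
    by (auto simp: admissible_measure_def I_minus_def I_plus_def)
  have curve: "{x. ?R x (\<gamma> s)} \<subset> {x. ?R x (\<gamma> t)} \<and> {x. ?R (\<gamma> t) x} \<subset> {x. ?R (\<gamma> s) x}"
    if \<gamma>: "future_causal_curve M \<gamma> a b" and st: "a \<le> s" "s < t" "t \<le> b" for \<gamma> a b s t
  proof -
    have mono: "{x. ?R x (\<gamma> s)} \<subseteq> {x. ?R x (\<gamma> t)}" "{x. ?R (\<gamma> t) x} \<subseteq> {x. ?R (\<gamma> s) x}"
      if "a \<le> s" "s < t" "t \<le> b" for s t
      using future_causal_curve_push_up[OF \<gamma> that] by (auto simp: push_up_def chron_less_eq_prec)
    \<comment> \<open>On a closed causal curve the past of an intermediate point
      \<open>\<gamma> u\<close> would be squeezed between equal sets, although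
      \<open>\<gamma> u\<close> can be chosen different from \<open>\<gamma> s\<close>.\<close>
    have "\<gamma> s \<noteq> \<gamma> t"
    proof
      assume eq: "\<gamma> s = \<gamma> t"
      obtain u where u: "u \<in> {s..t}" "\<gamma> u \<noteq> \<gamma> s"
        using future_causal_curve_not_constant[OF \<gamma> st] by blast
      then have "s < u" "u < t" using eq by (auto simp: order_less_le)
      then have "{x. ?R x (\<gamma> u)} = {x. ?R x (\<gamma> s)}"
        using mono(1)[of s u] mono(1)[of u t] st eq by auto
      then show False using dist u(2) by (auto simp: distinguishing_def I_minus_def)
    qed
    then show ?thesis
      using mono[OF st] dist by (auto simp: distinguishing_def I_minus_def I_plus_def)
  qed
  show "is_time_function M (past_volume M m)"
    unfolding is_time_function_def past_volume_def I_minus_def strict_mono_on_def o_def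
    using measure_past_continuous[OF outer(1) open_R m null(1)]
      measure_past_strict[OF trans(1) open_R dense(1) m pos] curve by fastforce
  \<comment> \<open>Futures are pasts of the reversed relation. They shrink along causal curves, and
    the minus sign turns this into increase.\<close>
  show "is_time_function M (future_volume M m)"
    unfolding is_time_function_def future_volume_def I_plus_def strict_mono_on_def o_def
    using measure_past_continuous[OF outer(2) open_R(2,1) m null(2)]
      measure_past_strict[OF trans(2) open_R(2,1) dense(2) m pos] curve
    by (fastforce intro: continuous_on_minus)
qed

end
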